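(* Let $\phi\in L^2(\mathbb{R})\setminus\{0\}$ be a window function, and let $f\in L^{2}(\mathbb{R})$ be such that $V_{\phi}^{A}f(\cdot,w)\in L^{2}(\mathbb{R})$ for every $w\in\mathbb{R}$. If for every $w\in\mathbb{R}$ $$\int_{\mathbb{R}^{2}}|f(t)\,V_{\phi}^{A}f(u,w)|\,e^{\left|\frac{tu}{b}\right|}\,dt\,du<\infty ,$$ then $f=0$.
   Context: Let $A=(a,b,c,d,u_{0},w_{0})$ with $a,b,c,d,u_0,w_0\in\mathbb{R}$, $ad-bc=1$ and $b\neq 0$. The offset linear canonical transform kernel is $$K_{A}(t,u)=\frac{1}{\sqrt{i2\pi b}}\,e^{i\frac{a}{2b}t^{2}-i\frac{1}{b}t(u-u_{0})-i\frac{1}{b}u(du_{0}-bw_{0})+i\frac{d}{2b}(u^{2}+u_{0}^{2})}.$$ For a window function $\phi\in L^2(\mathbb{R})\setminus\{0\}$, the windowed offset linear canonical transform (WOLCT) of $f\in L^2(\mathbb{R})$ is $$V^{A}_{\phi}f(u,w)=\int_{\mathbb{R}}f(t)\,\overline{\phi(t-w)}\,K_{A}(t,u)\,dt,\qquad (u,w)\in\mathbb{R}^2 .$$ *)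

theory Defs
  imports "HOL-Analysis.Analysis"
begin

text \<open>
  Elements of $L^2$ of the real line are represented by functions, so equality of elements is
  equality almost everywhere with respect to Lebesgue measure.
\<close>
definition square_integrable :: "(real \<Rightarrow> complex) \<Rightarrow> bool" where
  "square_integrable f \<longleftrightarrow>
     f \<in> borel_measurable lebesgue \<and> integrable lebesgue (\<lambda>t. (cmod (f t))\<^sup>2)"

text \<open>
  The square root is the principal branch. The entry \<open>c\<close> is determined by \<open>a * d - b * c = 1\<close>
  when \<open>b \<noteq> 0\<close> and does not occur in the formula.
\<close>
definition olct_kernel ::
  "real \<Rightarrow> real \<Rightarrow> real \<Rightarrow> real \<Rightarrow> real \<Rightarrow> real \<Rightarrow> real \<Rightarrow> real \<Rightarrow> complex" where
  "olct_kernel a b c d u0 w0 t u =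
     1 / csqrt (\<i> * of_real (2 * pi * b)) *
     exp (\<i> * of_real (a / (2 * b) * t\<^sup>2)
          - \<i> * of_real (1 / b * t * (u - u0))
          - \<i> * of_real (1 / b * u * (d * u0 - b * w0))
          + \<i> * of_real (d / (2 * b) * (u\<^sup>2 + u0\<^sup>2)))"

text \<open>
  For square integrable \<open>\<phi>\<close> and \<open>f\<close> the integrand is integrable by the Cauchy-Schwarz
  inequality, because the kernel has constant modulus in \<open>t\<close>.
\<close>
definition wolct ::
  "real \<Rightarrow> real \<Rightarrow> real \<Rightarrow> real \<Rightarrow> real \<Rightarrow> real \<Rightarrow>
   (real \<Rightarrow> complex) \<Rightarrow> (real \<Rightarrow> complex) \<Rightarrow> real \<Rightarrow> real \<Rightarrow> complex" where
  "wolct a b c d u0 w0 \<phi> f u w =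
     (LINT t|lebesgue. f t * cnj (\<phi> (t - w)) * olct_kernel a b c d u0 w0 t u)"

end

theory Submission
  imports Defs "HOL-Complex_Analysis.Complex_Analysis" "HOL-Real_Asymp.Real_Asymp" "HOL-Probability.Probability"
begin

text \<open>
  The modulus of the transform $V^A_\phi f(u,w)$ is, up to a constant, that of the Fourier transform at $u/b$ of
  $f(t)\,\overline{\phi(t-w)}$ times a chirp of modulus one. The statement is therefore a variant of Beurling's
  theorem: an integrable $h$ with $\iint |h(t)\hat h(y)|e^{|ty|}\,dt\,dy < \infty$ vanishes.
  
  It is not a direct consequence for a fixed $w$, because the hypothesis carries $|f(t)|$ and not
  $|f(t)\phi(t-w)|$, and the two are not comparable for an unbounded window. Since the hypothesis holds for every
  $w$, one may average over window positions. On a bounded set $S$ of positions on which the weighted integrals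
  are uniformly bounded, $h(t) = f(t)\int_S \overline{\phi(t-w)}\,dw$ is dominated by a multiple of $|f|$, and its
  Fourier transform is the average of the transforms for $w \in S$. So Beurling's theorem applies to $h$ and the
  average of the transforms vanishes (\<open>averaged_window_transform_vanishes\<close>). As $S$ may be
  replaced by any measurable subset, the transforms vanish for almost every $w$, and injectivity of the Fourier
  transform gives $f(t)\,\overline{\phi(t-w)} = 0$ almost everywhere (\<open>beurling_all_windows\<close>).
  
  Beurling's theorem (\<open>beurling\<close>) is proved along the lines of Hoermander. Convolution with a Gaussian preserves
  the hypothesis and makes the function entire of order two, with $|G(z)| \le M(|{\rm Im}\, z|)$ and
  $\int |G(x)|M(|x|)\,dx < \infty$. The primitive of $G(z)\,G(iz)$ is then bounded on the coordinate axes. A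
  quadrant is a critical sector for the Phragmen-Lindeloef principle at order two, so one factor is rotated by a
  small angle first, which leaves a slightly smaller sector and the same bounds
  (\<open>rotated_product_primitive_bounded\<close>). Liouville's theorem then makes $G(z)\,G(iz)$ vanish
  (\<open>hormander_entire_vanishes\<close>).
\<close>

section \<open>A Phragmen-Lindeloef principle for sectors\<close>

text \<open>
  The substitution $z = e^w$ turns the sector $|\arg z| \le \theta$ into a horizontal strip, so that the
  maximum principle can be applied on rectangles and the comparison function $\exp(-\varepsilon z^p)$
  with a fractional exponent becomes the entire function $\exp(-\varepsilon e^{p w})$. As the opening
  $2\theta$ is less than $\pi/2$, there is an exponent $p > 2$ with $p\theta < \pi/2$. The comparison
  function then beats the growth of order two on the right edge of a long rectangle, while on the far
  left edge the value is small because $F(0) = 0$.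
\<close>
lemma phragmen_lindelof_sector:
  fixes F :: "complex \<Rightarrow> complex"
  assumes hol: "F holomorphic_on UNIV"
    and growth: "\<And>z. cmod (F z) \<le> C * exp (D * (cmod z)\<^sup>2)"
    and th: "0 < \<theta>" "\<theta> < pi / 4"
    and F0: "F 0 = 0"
    and bnd: "\<And>x y. \<bar>y\<bar> = \<theta> \<Longrightarrow> cmod (F (exp (Complex x y))) \<le> B"
    and y: "\<bar>y\<bar> \<le> \<theta>"
  shows "cmod (F (exp (Complex x y))) \<le> B"
proof -
  have B0: "0 \<le> B" using norm_ge_zero[of "F (exp (Complex 0 \<theta>))"] bnd[of \<theta> 0] th by linarith
  \<comment> \<open>The mean of \<open>2\<close> and \<open>pi / (2 * \<theta>)\<close>: both \<open>p > 2\<close> and \<open>p * \<theta> < pi / 2\<close> are strict.\<close>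
  define p where "p = 1 + pi / (4 * \<theta>)"
  have p2: "p > 2" using th unfolding p_def by (simp add: field_simps)
  have pth: "p * \<theta> < pi / 2" "0 < p * \<theta>"
    using th p2 by (simp add: p_def field_simps, simp)
  define \<kappa> where "\<kappa> = cos (p * \<theta>)"
  have kpos: "\<kappa> > 0" unfolding \<kappa>_def using pth by (intro cos_gt_zero_pi) auto
  define g where "g = (\<lambda>e w. F (exp w) * exp (- of_real e * exp (of_real p * w)))"
  have holg: "g e holomorphic_on UNIV" for e
    unfolding g_def
    by (intro holomorphic_intros holomorphic_on_compose_gen[OF _ hol, unfolded o_def]) auto
  have gnorm: "cmod (g e (Complex u v)) = cmod (F (exp (Complex u v))) * exp (- e * exp (p * u) * cos (p * v))" for e u v
    unfolding g_def by (simp add: norm_mult norm_exp_eq_Re Re_exp)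
  have cosb: "\<kappa> \<le> cos (p * v)" if "\<bar>v\<bar> \<le> \<theta>" for v
  proof -
    have "cos (p * \<theta>) \<le> cos (p * \<bar>v\<bar>)"
      using that th p2 pth by (intro cos_monotone_0_pi_le mult_left_mono) auto
    moreover have "cos (p * \<bar>v\<bar>) = cos (p * v)" by (simp add: abs_if)
    ultimately show ?thesis by (simp add: \<kappa>_def)
  qed
  have gle: "cmod (g e (Complex u v)) \<le> cmod (F (exp (Complex u v))) * exp (- e * \<kappa> * exp (p * u))"
    if "\<bar>v\<bar> \<le> \<theta>" "e > 0" for e u v
    unfolding gnorm using cosb[OF that(1)] that(2) by (intro mult_left_mono) (auto simp: mult.commute mult.assoc intro!: mult_left_mono)
  have gF: "cmod (g e (Complex u v)) \<le> cmod (F (exp (Complex u v)))"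
    if "\<bar>v\<bar> \<le> \<theta>" "e > 0" for e u v
  proof -
    have "exp (- e * \<kappa> * exp (p * u)) \<le> 1" using that kpos by simp
    then show ?thesis using gle[OF that, of u] 
      by (smt (verit) mult_left_le norm_ge_zero)
  qed
  have main: "cmod (g e (Complex x y)) \<le> B + \<eta>" if e: "e > 0" and \<eta>: "\<eta> > 0" for e \<eta>
  proof -
    have "isCont F 0"
      using holomorphic_on_imp_continuous_on[OF hol] by (simp add: continuous_on_eq_continuous_at)
    then have "\<exists>\<delta>>0. \<forall>z. dist z 0 < \<delta> \<longrightarrow> dist (F z) (F 0) < \<eta>"
      using \<eta> unfolding continuous_at_eps_delta by blast
    then obtain \<delta> where \<delta>: "\<delta> > 0" "\<And>z. cmod z < \<delta> \<Longrightarrow> cmod (F z) < \<eta>"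
      by (auto simp: F0)
    define x0 where "x0 = min (x - 1) (ln (\<delta> / 2))"
    have "exp x0 \<le> exp (ln (\<delta> / 2))" by (simp add: x0_def)
    then have x0: "x0 < x" "exp x0 < \<delta>" using \<delta>(1) by (auto simp: x0_def)
    have ek: "e * \<kappa> > 0" using e kpos by simp
    have "((\<lambda>u. C * exp (D * exp u ^ 2 - e * \<kappa> * exp (p * u))) \<longlongrightarrow> 0) at_top"
    proof -
      have "filterlim (\<lambda>u. e * \<kappa> * exp ((p - 2) * u) - D) at_top at_top"
        using ek p2 by real_asymp
      moreover have "filterlim (\<lambda>u::real. exp u ^ 2) at_top at_top"
        by real_asymp
      ultimately have "filterlim (\<lambda>u. exp u ^ 2 * (e * \<kappa> * exp ((p - 2) * u) - D)) at_top at_top"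
        by (rule filterlim_at_top_mult_at_top[rotated])
      then have "filterlim (\<lambda>u. - (exp u ^ 2 * (e * \<kappa> * exp ((p - 2) * u) - D))) at_bot at_top"
        by (simp add: filterlim_uminus_at_bot)
      then have "((\<lambda>u. C * exp (- (exp u ^ 2 * (e * \<kappa> * exp ((p - 2) * u) - D)))) \<longlongrightarrow> C * 0) at_top"
        by (intro tendsto_mult tendsto_const filterlim_compose[OF exp_at_bot])
      moreover have "- (exp u ^ 2 * (e * \<kappa> * exp ((p - 2) * u) - D)) = D * exp u ^ 2 - e * \<kappa> * exp (p * u)" for u
      proof -
        have "exp u ^ 2 * exp ((p - 2) * u) = exp (p * u)"
          by (simp add: power2_eq_square flip: exp_add) (simp add: algebra_simps)
        then show ?thesis by (simp add: algebra_simps)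
      qed
      ultimately show ?thesis by simp
    qed
    then have "\<forall>\<^sub>F u in at_top. C * exp (D * exp u ^ 2 - e * \<kappa> * exp (p * u)) < \<eta>"
      using \<eta> by (rule order_tendstoD)
    moreover have "\<forall>\<^sub>F u in at_top. u > x" by (rule eventually_gt_at_top)
    ultimately have "\<forall>\<^sub>F u in at_top. u > x \<and> C * exp (D * exp u ^ 2 - e * \<kappa> * exp (p * u)) < \<eta>"
      by eventually_elim auto
    then obtain x1 where x1: "x1 > x" "C * exp (D * exp x1 ^ 2 - e * \<kappa> * exp (p * x1)) < \<eta>"
      by (metis (mono_tags, lifting) eventually_happens' trivial_limit_at_top_linorder)
    let ?S = "cbox (Complex x0 (-\<theta>)) (Complex x1 \<theta>)"
    show ?thesis
    proof (rule maximum_modulus_frontier[of "g e" ?S])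
      show "g e holomorphic_on interior ?S" using holg holomorphic_on_subset by blast
      show "continuous_on (closure ?S) (g e)"
        using holg holomorphic_on_imp_continuous_on continuous_on_subset by blast
      show "Complex x y \<in> ?S" using x0 x1 y by (auto simp: in_cbox_complex_iff)
      fix w assume "w \<in> frontier ?S"
      then have "w \<in> cbox (Complex x0 (-\<theta>)) (Complex x1 \<theta>) - box (Complex x0 (-\<theta>)) (Complex x1 \<theta>)"
        by (simp add: frontier_cbox)
      then obtain u v where w: "w = Complex u v" and uv: "x0 \<le> u" "u \<le> x1" "\<bar>v\<bar> \<le> \<theta>"
        and cs: "\<bar>v\<bar> = \<theta> \<or> u = x0 \<or> u = x1"
        by (cases w) (auto simp: in_cbox_complex_iff in_box_complex_iff)
      consider "\<bar>v\<bar> = \<theta>" | "u = x0" | "u = x1" using cs by blast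
      then show "cmod (g e w) \<le> B + \<eta>"
      proof cases
        case 1
        then show ?thesis using bnd[of v u] gF[OF uv(3) e, of u] \<eta> w by simp
      next
        case 2
        have "cmod (F (exp (Complex u v))) < \<eta>" by (rule \<delta>) (simp add: 2 x0)
        then show ?thesis using gF[OF uv(3) e, of u] B0 w by simp
      next
        case 3
        have "cmod (g e w) \<le> cmod (F (exp (Complex u v))) * exp (- e * \<kappa> * exp (p * u))"
          using gle[OF uv(3) e] w by simp
        also have "\<dots> \<le> (C * exp (D * (cmod (exp (Complex u v)))\<^sup>2)) * exp (- e * \<kappa> * exp (p * u))"
          by (intro mult_right_mono growth) auto
        also have "\<dots> = C * exp (D * exp x1 ^ 2 - e * \<kappa> * exp (p * x1))"
          using 3 by (simp add: exp_diff exp_minus field_simps)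
        finally show ?thesis using x1 B0 by simp
      qed
    qed simp
  qed
  have lim: "((\<lambda>e. cmod (g e (Complex x y))) \<longlongrightarrow> cmod (F (exp (Complex x y)))) (at_right 0)"
  proof -
    have "((\<lambda>e. cmod (F (exp (Complex x y))) * exp (- e * exp (p * x) * cos (p * y))) \<longlongrightarrow>
        cmod (F (exp (Complex x y))) * exp (- 0 * exp (p * x) * cos (p * y))) (at_right 0)"
      by (intro tendsto_intros)
    then show ?thesis unfolding gnorm by simp
  qed
  show ?thesis
  proof (rule field_le_epsilon)
    fix \<eta> :: real assume "\<eta> > 0"
    have "\<forall>\<^sub>F e in at_right (0::real). 0 < e" by (rule eventually_at_right_less)
    then have "\<forall>\<^sub>F e in at_right 0. cmod (g e (Complex x y)) \<le> B + \<eta>"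
      by eventually_elim (rule main[OF _ \<open>\<eta> > 0\<close>])
    then show "cmod (F (exp (Complex x y))) \<le> B + \<eta>"
      by (rule tendsto_upperbound[OF lim]) simp
  qed
qed

text \<open>
  Integrability of the derivative along the sides of a sector supplies the bounds from which the
  Phragmen-Lindeloef principle starts.
\<close>
lemma primitive_bounded_on_ray:
  fixes F P :: "complex \<Rightarrow> complex"
  assumes der: "\<And>z. (F has_field_derivative P z) (at z)" and F0: "F 0 = 0"
    and cont: "continuous_on UNIV P"
    and u: "cmod u = 1" and r: "r \<ge> 0" and B: "B \<ge> 0"
    and bnd: "(\<integral>\<^sup>+s. ennreal (cmod (P (of_real s * u))) * indicator {0..} s \<partial>lborel) \<le> ennreal B"
  shows "cmod (F (of_real r * u)) \<le> B"
proof -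
  have "has_bochner_integral lborel (\<lambda>s. indicator {0..r} s *\<^sub>R (P (of_real s * u) * u)) (F (of_real r * u) - F (of_real 0 * u))"
  proof (rule has_bochner_integral_FTC_Icc)
    fix s :: real
    show "((\<lambda>s. F (of_real s * u)) has_vector_derivative P (of_real s * u) * u) (at s within {0..r})"
      by (rule has_vector_derivative_real_field[OF DERIV_chain2[OF der]]) (auto intro!: derivative_eq_intros)
    show "continuous_on {0..r} (\<lambda>s. P (of_real s * u) * u)"
      by (intro continuous_intros continuous_on_compose2[OF cont]) auto
  qed fact
  then have *: "integrable lborel (\<lambda>s. indicator {0..r} s *\<^sub>R (P (of_real s * u) * u))"
    "(LINT s|lborel. indicator {0..r} s *\<^sub>R (P (of_real s * u) * u)) = F (of_real r * u)"
    by (auto simp: has_bochner_integral_iff F0)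
  have "ennreal (cmod (F (of_real r * u))) \<le> (\<integral>\<^sup>+s. ennreal (norm (indicator {0..r} s *\<^sub>R (P (of_real s * u) * u))) \<partial>lborel)"
    using integral_norm_bound_ennreal[OF *(1)] *(2) by simp
  also have "\<dots> \<le> (\<integral>\<^sup>+s. ennreal (cmod (P (of_real s * u))) * indicator {0..} s \<partial>lborel)"
    by (intro nn_integral_mono) (auto simp: norm_mult u indicator_def)
  also note bnd
  finally show ?thesis using B by simp
qed

text \<open>
  In this form the primitive visibly depends continuously on parameters of the integrand.
\<close>
lemma primitive_segment_integral:
  fixes F P :: "complex \<Rightarrow> complex"
  assumes der: "\<And>z. (F has_field_derivative P z) (at z)" and F0: "F 0 = 0"
  shows "F z = integral {0..1} (\<lambda>s. P (of_real s * z) * z)"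
proof -
  have "((\<lambda>s. P (of_real s * z) * z) has_integral F (of_real 1 * z) - F (of_real 0 * z)) {0..1}"
    by (rule fundamental_theorem_of_calculus)
      (auto intro!: has_vector_derivative_real_field[OF DERIV_chain2[OF der]] derivative_eq_intros)
  then have "((\<lambda>s. P (of_real s * z) * z) has_integral F z) {0..1}" by (simp add: F0)
  then show ?thesis by (rule integral_unique[symmetric])
qed

lemma entire_primitive:
  assumes "P holomorphic_on UNIV"
  obtains F where "\<And>z. (F has_field_derivative P z) (at z)" "F 0 = (0::complex)"
proof -
  obtain g where g: "\<And>x. x \<in> UNIV \<Longrightarrow> (g has_field_derivative P x) (at x within UNIV)"
    using holomorphic_convex_primitive'[of UNIV P] assms by auto
  show ?thesis
    by (rule that[of "\<lambda>z. g z - g 0"]) (use g in \<open>auto intro!: derivative_eq_intros\<close>)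
qed

section \<open>Vanishing of entire functions of order two\<close>

lemma exp_Complex_cis: "exp (Complex x y) = of_real (exp x) * cis y"
  by (simp add: exp_eq_polar)

lemma entire_compose:
  assumes "G holomorphic_on UNIV" "f holomorphic_on A"
  shows "(\<lambda>z. G (f z)) holomorphic_on A"
  using holomorphic_on_compose_gen[OF assms(2,1)] by (simp add: o_def)

text \<open>
  The primitive of $G_1(z)\,G_2(iz)$ is bounded on the positive real and imaginary axes, where one factor is
  evaluated on the real line and the other is controlled by $M$. The quadrant between the axes has opening
  $\pi/2$, which is exactly the critical angle for functions of order two. Turning the argument of $G_1$ by
  $-\alpha$ moves the real side to $\arg z = \alpha$: there $G_1$ is evaluated at real points and $G_2$ at
  imaginary part $s\cos\alpha \le s$, and on the imaginary axis the roles are exchanged. The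
  remaining sector has opening $\pi/2 - \alpha$, and the bound $B$ does not depend on $\alpha$.
\<close>
lemma rotated_product_primitive_bounded:
  fixes G1 G2 :: "complex \<Rightarrow> complex" and M :: "real \<Rightarrow> real"
  assumes hol: "G1 holomorphic_on UNIV" "G2 holomorphic_on UNIV"
    and le: "\<And>z. cmod (G1 z) \<le> M \<bar>Im z\<bar>" "\<And>z. cmod (G2 z) \<le> M \<bar>Im z\<bar>"
    and mono: "\<And>s t. 0 \<le> s \<Longrightarrow> s \<le> t \<Longrightarrow> M s \<le> M t"
    and growth: "\<And>t. 0 \<le> t \<Longrightarrow> M t \<le> C * exp (D * t\<^sup>2)"
    and B: "0 \<le> B"
    and int: "(\<integral>\<^sup>+x. ennreal (cmod (G1 (of_real x)) * M \<bar>x\<bar>) \<partial>lborel) \<le> ennreal B"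
             "(\<integral>\<^sup>+x. ennreal (cmod (G2 (- of_real x)) * M \<bar>x\<bar>) \<partial>lborel) \<le> ennreal B"
    and \<alpha>: "0 < \<alpha>" "\<alpha> \<le> t" "t < pi / 2" and r: "0 < r"
    and der: "\<And>z. (F has_field_derivative G1 (cis (-\<alpha>) * z) * G2 (\<i> * z)) (at z)" and F0: "F 0 = 0"
  shows "cmod (F (of_real r * cis t)) \<le> B"
proof -
  have M0: "0 \<le> M s" if "s \<ge> 0" for s
  proof -
    have "cmod (G1 (Complex 0 s)) \<le> M s" using le(1)[of "Complex 0 s"] that by simp
    then show ?thesis using norm_ge_zero order_trans by blast
  qed
  have holc: "(\<lambda>z. G1 (a * z)) holomorphic_on S" "(\<lambda>z. G2 (a * z)) holomorphic_on S" for a S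
    by (intro entire_compose[OF hol(1)] entire_compose[OF hol(2)]
        holomorphic_on_mult holomorphic_on_const holomorphic_on_ident)+
  let ?P = "\<lambda>z. G1 (cis (-\<alpha>) * z) * G2 (\<i> * z)"
  have contP: "continuous_on UNIV ?P"
    by (intro holomorphic_on_imp_continuous_on holomorphic_intros holc)
  have Pbd: "cmod (?P w) \<le> (M R)\<^sup>2" if "cmod w \<le> R" for w R
  proof -
    have *: "\<bar>Im v\<bar> \<le> R" if "cmod v = cmod w" for v 
      using abs_Im_le_cmod[of v] that \<open>cmod w \<le> R\<close> by simp
    have R0: "0 \<le> R" using that norm_ge_zero order_trans by blast
    have "cmod (G1 (cis (-\<alpha>) * w)) \<le> M R"
      by (rule order_trans[OF le(1) mono[OF _ *]]) (simp_all add: norm_mult)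
    moreover have "cmod (G2 (\<i> * w)) \<le> M R"
      by (rule order_trans[OF le(2) mono[OF _ *]]) (simp_all add: norm_mult)
    ultimately show ?thesis 
      unfolding norm_mult power2_eq_square using M0[OF R0] by (intro mult_mono) auto
  qed
  have Fgr: "cmod (F z) \<le> C\<^sup>2 * exp ((2 * D + 1) * (cmod z)\<^sup>2)" for z
  proof -
    have "cmod (F z - F 0) \<le> (M (cmod z))\<^sup>2 * cmod (z - 0)"
      by (rule field_differentiable_bound[of "cball 0 (cmod z)" F ?P])
        (auto intro!: has_field_derivative_at_within[OF der] Pbd)
    also have "\<dots> \<le> (C * exp (D * (cmod z)\<^sup>2))\<^sup>2 * exp ((cmod z)\<^sup>2)"
    proof (intro mult_mono power_mono growth M0)
      have "cmod z \<le> 1 + (cmod z)\<^sup>2" 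
        using zero_le_power2[of "cmod z - 1"] norm_ge_zero[of z]
        unfolding power2_diff one_power2 by linarith
      also have "\<dots> \<le> exp ((cmod z)\<^sup>2)" by (rule exp_ge_add_one_self)
      finally show "cmod (z - 0) \<le> exp ((cmod z)\<^sup>2)" by simp
    qed auto
    also have "\<dots> = C\<^sup>2 * exp ((2 * D + 1) * (cmod z)\<^sup>2)"
      by (simp add: power_mult_distrib distrib_right exp_add flip: exp_double)
    finally show ?thesis by (simp add: F0)
  qed
  have cos: "0 \<le> cos \<alpha>" "cos \<alpha> \<le> 1" using \<alpha> by (auto intro!: cos_ge_zero)
  have shrink: "M \<bar>s * cos \<alpha>\<bar> \<le> M \<bar>s\<bar>" for s
    using cos by (intro mono) (auto simp: abs_mult mult_left_le)
  have ray1: "cmod (F (of_real s * cis \<alpha>)) \<le> B" if "0 \<le> s" for s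
  proof (rule primitive_bounded_on_ray[OF der F0 contP _ that B])
    have "cmod (?P (of_real s * cis \<alpha>)) \<le> cmod (G1 (of_real s)) * M \<bar>s\<bar>" for s
    proof -
      have "cis (-\<alpha>) * (of_real s * cis \<alpha>) = of_real s"
        by (simp add: cis_mult mult.left_commute[of "cis _"])
      moreover have "cmod (G2 (\<i> * (of_real s * cis \<alpha>))) \<le> M \<bar>s\<bar>"
        using le(2)[of "\<i> * (of_real s * cis \<alpha>)"] shrink[of s] by simp
      ultimately show ?thesis by (simp only: norm_mult mult_left_mono norm_ge_zero)
    qed
    note * = this[THEN ennreal_leI]
    have "(\<integral>\<^sup>+s. ennreal (cmod (?P (of_real s * cis \<alpha>))) * indicator {0..} s \<partial>lborel)
        \<le> (\<integral>\<^sup>+x. ennreal (cmod (G1 (of_real x)) * M \<bar>x\<bar>) \<partial>lborel)"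
      by (intro nn_integral_mono order_trans[OF _ *]) (simp add: indicator_def)
    then show "(\<integral>\<^sup>+s. ennreal (cmod (?P (of_real s * cis \<alpha>))) * indicator {0..} s \<partial>lborel) \<le> ennreal B"
      using int(1) by (rule order_trans)
  qed simp
  have ray2: "cmod (F (of_real s * \<i>)) \<le> B" if "0 \<le> s" for s
  proof (rule primitive_bounded_on_ray[OF der F0 contP _ that B])
    have "cmod (?P (of_real s * \<i>)) \<le> cmod (G2 (- of_real s)) * M \<bar>s\<bar>" for s
    proof -
      have "\<i> * (of_real s * \<i>) = - of_real s" by (simp add: complex_eq_iff)
      moreover have "cmod (G1 (cis (-\<alpha>) * (of_real s * \<i>))) \<le> M \<bar>s\<bar>"
        using le(1)[of "cis (-\<alpha>) * (of_real s * \<i>)"] shrink[of s] by (simp add: mult.commute)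
      ultimately show ?thesis
        by (subst mult.commute) (simp only: norm_mult mult_left_mono norm_ge_zero)
    qed
    note * = this[THEN ennreal_leI]
    have "(\<integral>\<^sup>+s. ennreal (cmod (?P (of_real s * \<i>))) * indicator {0..} s \<partial>lborel)
        \<le> (\<integral>\<^sup>+x. ennreal (cmod (G2 (- of_real x)) * M \<bar>x\<bar>) \<partial>lborel)"
      by (intro nn_integral_mono order_trans[OF _ *]) (simp add: indicator_def)
    then show "(\<integral>\<^sup>+s. ennreal (cmod (?P (of_real s * \<i>))) * indicator {0..} s \<partial>lborel) \<le> ennreal B"
      using int(2) by (rule order_trans)
  qed simp
  \<comment> \<open>The sector between the directions \<open>\<alpha>\<close> and \<open>pi / 2\<close> has axis \<open>m\<close> and half-opening \<open>\<theta>\<close>.\<close>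
  define \<theta> where "\<theta> = (pi / 2 - \<alpha>) / 2"
  define m where "m = (pi / 2 + \<alpha>) / 2"
  have "cmod (F (cis m * exp (Complex (ln r) (t - m)))) \<le> B"
  proof (rule phragmen_lindelof_sector[of "\<lambda>z. F (cis m * z)" "C\<^sup>2" "2 * D + 1" \<theta>])
    have "F holomorphic_on UNIV"
      using der field_differentiable_def holomorphic_on_open[of UNIV F] by auto
    then show "(\<lambda>z. F (cis m * z)) holomorphic_on UNIV"
      by (rule entire_compose) (intro holomorphic_intros)
    show "cmod (F (cis m * z)) \<le> C\<^sup>2 * exp ((2 * D + 1) * (cmod z)\<^sup>2)" for z
      using Fgr[of "cis m * z"] by (simp add: norm_mult)
    show "0 < \<theta>" "\<theta> < pi / 4" "\<bar>t - m\<bar> \<le> \<theta>"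
      using \<alpha> by (auto simp: \<theta>_def m_def abs_if field_simps)
    show "F (cis m * 0) = 0" by (simp add: F0)
    fix x y :: real assume "\<bar>y\<bar> = \<theta>"
    then consider "m + y = pi / 2" | "m + y = \<alpha>"
      by (auto simp: \<theta>_def m_def abs_if field_simps split: if_splits)
    moreover have "cis m * exp (Complex x y) = of_real (exp x) * cis (m + y)"
      by (simp add: exp_Complex_cis cis_mult mult.left_commute)
    ultimately show "cmod (F (cis m * exp (Complex x y))) \<le> B"
      using ray1[of "exp x"] ray2[of "exp x"] by cases simp_all
  qed
  then show ?thesis using r by (simp add: exp_Complex_cis cis_mult mult.left_commute[of "cis _"])
qed

text \<open>
  A point of the open quadrant lies in all the smaller sectors with $\alpha$ below its argument, so the bound
  survives the limit $\alpha \to 0$.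
\<close>
lemma product_primitive_bounded_quadrant:
  fixes G1 G2 :: "complex \<Rightarrow> complex" and M :: "real \<Rightarrow> real"
  assumes hol: "G1 holomorphic_on UNIV" "G2 holomorphic_on UNIV"
    and le: "\<And>z. cmod (G1 z) \<le> M \<bar>Im z\<bar>" "\<And>z. cmod (G2 z) \<le> M \<bar>Im z\<bar>"
    and mono: "\<And>s t. 0 \<le> s \<Longrightarrow> s \<le> t \<Longrightarrow> M s \<le> M t"
    and growth: "\<And>t. 0 \<le> t \<Longrightarrow> M t \<le> C * exp (D * t\<^sup>2)"
    and B: "0 \<le> B"
    and int: "(\<integral>\<^sup>+x. ennreal (cmod (G1 (of_real x)) * M \<bar>x\<bar>) \<partial>lborel) \<le> ennreal B"
             "(\<integral>\<^sup>+x. ennreal (cmod (G2 (- of_real x)) * M \<bar>x\<bar>) \<partial>lborel) \<le> ennreal B"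
    and der: "\<And>z. (F has_field_derivative G1 z * G2 (\<i> * z)) (at z)" and F0: "F 0 = 0"
    and z: "0 < Re z" "0 < Im z"
  shows "cmod (F z) \<le> B"
proof -
  define r where "r = cmod z"
  define t where "t = Arg z"
  have z_eq: "z = of_real r * cis t" unfolding r_def t_def by (rule rcis_cmod_Arg[symmetric, unfolded rcis_def])
  have r: "0 < r" using z by (auto simp: r_def)
  have t: "0 < t" "t < pi / 2"
    using z Arg_lt_pi[of z] Arg_Re_pos[of z] by (auto simp: t_def)
  let ?P = "\<lambda>\<alpha> z. G1 (cis (-\<alpha>) * z) * G2 (\<i> * z)"
  define I where "I \<alpha> = integral (cbox 0 1) (\<lambda>s. ?P \<alpha> (of_real s * z) * z)" for \<alpha>
  have cont: "continuous_on UNIV G1" "continuous_on UNIV G2"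
    using hol by (auto intro: holomorphic_on_imp_continuous_on)
  have "continuous_on UNIV I"
    unfolding I_def
    by (intro integral_continuous_on_param)
      (auto simp: split_beta intro!: continuous_intros continuous_on_compose2[OF cont(1)] continuous_on_compose2[OF cont(2)])
  then have "isCont I 0" by (simp add: continuous_on_eq_continuous_at)
  then have "(I \<longlongrightarrow> I 0) (at_right 0)"
    unfolding isCont_def by (rule tendsto_mono[rotated]) (simp add: at_le)
  moreover have "I 0 = F z"
    using primitive_segment_integral[OF der F0, of z] by (simp add: I_def)
  ultimately have lim: "((\<lambda>\<alpha>. cmod (I \<alpha>)) \<longlongrightarrow> cmod (F z)) (at_right 0)"
    by (simp add: tendsto_norm)
  have bnd: "cmod (I \<alpha>) \<le> B" if \<alpha>: "0 < \<alpha>" "\<alpha> < t" for \<alpha>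
  proof -
    have "(\<lambda>z. ?P \<alpha> z) holomorphic_on UNIV"
      by (intro holomorphic_on_mult entire_compose[OF hol(1)] entire_compose[OF hol(2)]
          holomorphic_on_const holomorphic_on_ident)
    from entire_primitive[OF this]
    obtain H where H: "\<And>z. (H has_field_derivative ?P \<alpha> z) (at z)" "H 0 = 0"
      by blast
    have "cmod (H (of_real r * cis t)) \<le> B"
      by (rule rotated_product_primitive_bounded[OF hol le mono growth B int \<alpha>(1) _ t(2) r H])
        (use \<alpha> in auto)
    then show ?thesis
      using primitive_segment_integral[OF H, of z] by (simp add: I_def z_eq)
  qed
  have "\<forall>\<^sub>F \<alpha> in at_right 0. \<alpha> \<in> {0<..<t}" using t by (intro eventually_at_right_real)
  then have "\<forall>\<^sub>F \<alpha> in at_right 0. cmod (I \<alpha>) \<le> B"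
    by eventually_elim (auto intro: bnd)
  then show ?thesis by (rule tendsto_upperbound[OF lim]) simp
qed

lemma entire_product_zero:
  fixes G :: "complex \<Rightarrow> complex"
  assumes hol: "G holomorphic_on UNIV" and c: "c \<noteq> 0" and zero: "\<And>z. G z * G (c * z) = 0"
  shows "G z = 0"
proof (rule ccontr)
  assume nz: "G z \<noteq> 0"
  let ?U = "{w. G (w / c) \<noteq> 0}"
  have "(\<lambda>w. w / c) holomorphic_on UNIV"
    unfolding divide_inverse by (rule holomorphic_on_mult[OF holomorphic_on_ident holomorphic_on_const])
  then have "(\<lambda>w. G (w / c)) holomorphic_on UNIV"
    by (rule entire_compose[OF hol])
  from open_Collect_neq[OF holomorphic_on_imp_continuous_on[OF this] continuous_on_const]
  have "open ?U" .
  moreover have "c * z \<in> ?U" using nz c by simp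
  then have "?U \<noteq> {}" by blast
  moreover have "G w = 0" if "w \<in> ?U" for w
  proof -
    have "G (w / c) * G (c * (w / c)) = 0" by (rule zero)
    then show ?thesis using that c by simp
  qed
  ultimately have "G z = 0"
    using analytic_continuation_open[OF _ open_UNIV _ connected_UNIV subset_UNIV hol holomorphic_on_const]
    by blast
  then show False using nz by simp
qed

text \<open>
  Following Hoermander, consider the primitive $F$ of $G(z)\,G(iz)$. The substitutions $z \mapsto i^k z$
  carry each of the four open quadrants to the first one and replace the two factors by $G(\pm z)$, so
  $F$ is bounded off the axes and then everywhere by continuity. By Liouville $F$ is constant, hence
  $G(z)\,G(iz) = 0$ identically, which forces $G = 0$.
\<close>
lemma hormander_entire_vanishes:
  fixes G :: "complex \<Rightarrow> complex" and M :: "real \<Rightarrow> real"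
  assumes hol: "G holomorphic_on UNIV"
    and le: "\<And>z. cmod (G z) \<le> M \<bar>Im z\<bar>"
    and mono: "\<And>s t. 0 \<le> s \<Longrightarrow> s \<le> t \<Longrightarrow> M s \<le> M t"
    and growth: "\<And>t. 0 \<le> t \<Longrightarrow> M t \<le> C * exp (D * t\<^sup>2)"
    and int: "(\<integral>\<^sup>+x. ennreal (cmod (G (of_real x)) * M \<bar>x\<bar>) \<partial>lborel) < \<infinity>"
  shows "G z = 0"
proof -
  define B where "B = enn2real (\<integral>\<^sup>+x. ennreal (cmod (G (of_real x)) * M \<bar>x\<bar>) \<partial>lborel)"
  have B: "0 \<le> B" by (simp add: B_def)
  have intp: "(\<integral>\<^sup>+x. ennreal (cmod (G (of_real x)) * M \<bar>x\<bar>) \<partial>lborel) \<le> ennreal B"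
    using int by (simp add: B_def)
  have "mono_on {0..} M" using mono by (auto simp: mono_on_def)
  then have "M \<in> borel_measurable (restrict_space borel {0..})"
    by (rule borel_measurable_mono_on_fnc)
  then have [measurable]: "(\<lambda>x. if x \<in> {0..} then M x else 0) \<in> borel_measurable borel"
    by (subst (asm) measurable_restrict_space_iff[of _ _ 0]) auto
  have "(\<lambda>x. (\<lambda>x. if x \<in> {0..} then M x else 0) \<bar>x\<bar>) \<in> borel_measurable borel"
    by (rule measurable_compose[where N = borel]) measurable
  then have [measurable]: "(\<lambda>x. M \<bar>x\<bar>) \<in> borel_measurable borel" by simp
  have "continuous_on UNIV G" using hol by (rule holomorphic_on_imp_continuous_on)
  then have [measurable]: "G \<in> borel_measurable borel" by (rule borel_measurable_continuous_onI)
  have intm: "(\<integral>\<^sup>+x. ennreal (cmod (G (- of_real x)) * M \<bar>x\<bar>) \<partial>lborel) \<le> ennreal B"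
    using intp by (subst (asm) nn_integral_real_affine[where c="-1" and t=0]) auto
  have "(\<lambda>z. G z * G (\<i> * z)) holomorphic_on UNIV"
      by (intro holomorphic_on_mult hol entire_compose[OF hol] holomorphic_on_const holomorphic_on_ident)
  from entire_primitive[OF this]
  obtain F where F: "\<And>z. (F has_field_derivative G z * G (\<i> * z)) (at z)" "F 0 = 0"
    by blast
  let ?m = "\<lambda>z. G (- z)"
  have holm: "?m holomorphic_on UNIV"
    by (intro entire_compose[OF hol] holomorphic_on_minus holomorphic_on_ident)
  have lem: "cmod (?m z) \<le> M \<bar>Im z\<bar>" for z using le[of "- z"] by simp
  have intmm: "(\<integral>\<^sup>+x. ennreal (cmod (?m (- of_real x)) * M \<bar>x\<bar>) \<partial>lborel) \<le> ennreal B"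
    using intp by simp
  have q1: "cmod (F z) \<le> B" if "0 < Re z" "0 < Im z" for z
    by (rule product_primitive_bounded_quadrant[OF hol hol le le mono growth B intp intm F that])
  \<comment> \<open>A rotation of the argument of \<open>F\<close> yields, up to a constant, a primitive of the product of rotated factors.\<close>
  have scale: "((\<lambda>z. k * F (c * z)) has_field_derivative k * (G (c * z) * G (\<i> * (c * z)) * c)) (at z)" for k c z
    by (intro DERIV_cmult DERIV_chain2[OF F(1)] DERIV_cmult_Id)
  have q2: "cmod (F (\<i> * z)) \<le> B" if "0 < Re z" "0 < Im z" for z
  proof -
    have "cmod (- \<i> * F (\<i> * z)) \<le> B"
    proof (rule product_primitive_bounded_quadrant[OF holm hol lem le mono growth B intm intm _ _ that])
      show "((\<lambda>z. - \<i> * F (\<i> * z)) has_field_derivative ?m z * G (\<i> * z)) (at z)" for z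
        using scale[of "- \<i>" "\<i>" z] by (simp add: mult_ac)
    qed (simp_all add: F(2))
    then show ?thesis by (simp add: norm_mult)
  qed
  have q3: "cmod (F (- z)) \<le> B" if "0 < Re z" "0 < Im z" for z
  proof -
    have "cmod (- F (- z)) \<le> B"
    proof (rule product_primitive_bounded_quadrant[OF holm holm lem lem mono growth B intm intmm _ _ that])
      show "((\<lambda>z. - F (- z)) has_field_derivative ?m z * ?m (\<i> * z)) (at z)" for z
        using scale[of "- 1" "- 1" z] by (simp add: mult_ac)
    qed (simp_all add: F(2))
    then show ?thesis by (simp add: norm_mult)
  qed
  have q4: "cmod (F (- \<i> * z)) \<le> B" if "0 < Re z" "0 < Im z" for z
  proof -
    have "cmod (\<i> * F (- \<i> * z)) \<le> B"
    proof (rule product_primitive_bounded_quadrant[OF hol holm le lem mono growth B intp intmm _ _ that])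
      show "((\<lambda>z. \<i> * F (- \<i> * z)) has_field_derivative G z * ?m (\<i> * z)) (at z)" for z
        using scale[of "\<i>" "- \<i>" z] by (simp add: mult_ac)
    qed (simp_all add: F(2))
    then show ?thesis by (simp add: norm_mult)
  qed
  have off: "cmod (F z) \<le> B" if "Re z \<noteq> 0" "Im z \<noteq> 0" for z
    using q1[of z] q2[of "- \<i> * z"] q3[of "- z"] q4[of "\<i> * z"] that
    by (cases "Re z > 0"; cases "Im z > 0") (auto simp: not_less)
  have contF: "continuous_on UNIV F"
    by (intro continuous_at_imp_continuous_on ballI DERIV_isCont[OF F(1)])
  have all: "cmod (F z) \<le> B" for z
  proof -
    let ?f = "\<lambda>e::real. z + of_real e * Complex 1 1"
    have "continuous_on UNIV (\<lambda>e. cmod (F (?f e)))"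
      by (intro continuous_on_norm continuous_on_compose2[OF contF] continuous_intros) auto
    then have "((\<lambda>e. cmod (F (?f e))) \<longlongrightarrow> cmod (F (?f 0))) (at 0)"
      unfolding continuous_on_eq_continuous_at[OF open_UNIV] isCont_def by blast
    moreover have "\<forall>\<^sub>F e in at (0::real). e \<noteq> - Re z" "\<forall>\<^sub>F e in at (0::real). e \<noteq> - Im z"
      by (rule eventually_neq_at_within)+
    then have "\<forall>\<^sub>F e in at (0::real). cmod (F (?f e)) \<le> B"
      by eventually_elim (rule off, auto simp: add_eq_0_iff)
    ultimately have "cmod (F (?f 0)) \<le> B"
      by (rule tendsto_upperbound) simp
    then show ?thesis by simp
  qed
  have "F holomorphic_on UNIV" using F(1) holomorphic_on_open[of UNIV F] by auto
  moreover have "bounded (range F)" using all by (auto simp: bounded_iff)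
  ultimately have "F constant_on UNIV" by (rule Liouville_theorem)
  then obtain k where "\<And>z. F z = k" by (auto simp: constant_on_def)
  then have "F = (\<lambda>_. k)" by auto
  then have "G z * G (\<i> * z) = 0" for z
    using F(1)[of z] DERIV_unique DERIV_const by metis
  then show ?thesis
    using entire_product_zero[OF hol complex_i_not_zero] by blast
qed

section \<open>Gaussian integrals and Fourier-Laplace transforms\<close>

lemma has_bochner_integral_gaussian_shift:
  "has_bochner_integral lborel (\<lambda>x::real. exp (- x\<^sup>2 / 2 + s * x)) (sqrt (2 * pi) * exp (s\<^sup>2 / 2))"
proof -
  have "has_bochner_integral lborel (normal_density s 1) 1"
    by (simp add: has_bochner_integral_iff)
  from has_bochner_integral_mult_right[OF this, of "sqrt (2 * pi) * exp (s\<^sup>2 / 2)"]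
  have "has_bochner_integral lborel (\<lambda>x. (sqrt (2 * pi) * exp (s\<^sup>2 / 2)) * normal_density s 1 x) (sqrt (2 * pi) * exp (s\<^sup>2 / 2))"
    by simp
  moreover have "(sqrt (2 * pi) * exp (s\<^sup>2 / 2)) * normal_density s 1 x = exp (- x\<^sup>2 / 2 + s * x)" for x
  proof -
    have "exp (s\<^sup>2 / 2) * exp (- (x - s)\<^sup>2 / 2) = exp (- x\<^sup>2 / 2 + s * x)"
      by (simp add: exp_add[symmetric] power2_eq_square field_simps)
    then show ?thesis by (simp add: normal_density_def)
  qed
  ultimately show ?thesis by simp
qed

lemma gaussian_abs_integral:
  "integrable lborel (\<lambda>x::real. exp (- x\<^sup>2 / 2 + s * \<bar>x\<bar>))"
  "(LINT x|lborel. exp (- x\<^sup>2 / 2 + s * \<bar>x\<bar>)) \<le> 2 * sqrt (2 * pi) * exp (s\<^sup>2 / 2)"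
proof -
  note g = has_bochner_integral_gaussian_shift[of s] has_bochner_integral_gaussian_shift[of "- s"]
  from has_bochner_integral_add[OF g]
  have i: "integrable lborel (\<lambda>x::real. exp (- x\<^sup>2 / 2 + s * x) + exp (- x\<^sup>2 / 2 + - s * x))"
    and v: "(LINT x|lborel. exp (- x\<^sup>2 / 2 + s * x) + exp (- x\<^sup>2 / 2 + - s * x)) = 2 * sqrt (2 * pi) * exp (s\<^sup>2 / 2)"
    unfolding has_bochner_integral_iff by simp_all
  have le: "exp (- x\<^sup>2 / 2 + s * \<bar>x\<bar>) \<le> exp (- x\<^sup>2 / 2 + s * x) + exp (- x\<^sup>2 / 2 + - s * x)" for x
    by (cases "x \<ge> 0") auto
  show i': "integrable lborel (\<lambda>x::real. exp (- x\<^sup>2 / 2 + s * \<bar>x\<bar>))"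
    by (rule Bochner_Integration.integrable_bound[OF i]) (use le in \<open>auto intro: order_trans[OF _ abs_ge_self]\<close>)
  show "(LINT x|lborel. exp (- x\<^sup>2 / 2 + s * \<bar>x\<bar>)) \<le> 2 * sqrt (2 * pi) * exp (s\<^sup>2 / 2)"
    unfolding v[symmetric] by (rule integral_mono[OF i' i le])
qed

text \<open>
  The characteristic function of the standard normal distribution, without its normalization.
\<close>
lemma gaussian_fourier_integral:
  "(CLINT y|lborel. of_real (exp (- y\<^sup>2 / 2)) * iexp (x * y)) = of_real (sqrt (2 * pi) * exp (- x\<^sup>2 / 2))"
proof -
  have "of_real (exp (- x\<^sup>2 / 2)) = char std_normal_distribution x"
    by (simp add: char_std_normal_distribution)
  also have "\<dots> = (CLINT y|lborel. std_normal_density y *\<^sub>R iexp (x * y))"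
    unfolding char_def by (subst integral_density) auto
  also have "\<dots> = (CLINT y|lborel. of_real (1 / sqrt (2 * pi)) * (of_real (exp (- y\<^sup>2 / 2)) * iexp (x * y)))"
    by (simp add: normal_density_def scaleR_conv_of_real mult.assoc)
  also have "\<dots> = of_real (1 / sqrt (2 * pi)) * (CLINT y|lborel. of_real (exp (- y\<^sup>2 / 2)) * iexp (x * y))"
    by (rule integral_mult_right_zero)
  finally have "of_real (sqrt (2 * pi)) * of_real (exp (- x\<^sup>2 / 2)) = 
     of_real (sqrt (2 * pi)) * (of_real (1 / sqrt (2 * pi)) * (CLINT y|lborel. of_real (exp (- y\<^sup>2 / 2)) * iexp (x * y)))"
    by simp
  then show ?thesis by (simp add: field_simps)
qed

text \<open>
  Integrating the exponential series term by term gives a power series that converges in the whole plane.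
\<close>
lemma fourier_laplace_entire:
  fixes K :: "real \<Rightarrow> complex"
  assumes [measurable]: "K \<in> borel_measurable borel"
    and int: "\<And>t. 0 \<le> t \<Longrightarrow> integrable lborel (\<lambda>y. cmod (K y) * exp (t * \<bar>y\<bar>))"
  shows "(\<lambda>z. CLINT y|lborel. K y * exp (\<i> * of_real y * z)) holomorphic_on UNIV"
proof -
  define a where "a n = (CLINT y|lborel. K y * ((\<i> * of_real y) ^ n / fact n))" for n
  have sums: "(\<lambda>n. a n * (z - 0) ^ n) sums (CLINT y|lborel. K y * exp (\<i> * of_real y * z))" for z
  proof -
    let ?w = "\<lambda>y. cmod (K y) * exp (cmod z * \<bar>y\<bar>)"
    let ?s = "\<lambda>n y. K y * (\<Sum>k<n. (\<i> * of_real y * z) ^ k /\<^sub>R fact k)"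
    have part: "(\<Sum>k<n. (cmod z * \<bar>y\<bar>) ^ k /\<^sub>R fact k) \<le> exp (cmod z * \<bar>y\<bar>)" for n and y :: real
      unfolding exp_def by (rule sum_le_suminf[OF summable_exp_generic]) auto
    have termb: "cmod ((\<i> * of_real y * z) ^ k /\<^sub>R fact k) = (cmod z * \<bar>y\<bar>) ^ k /\<^sub>R fact k" for k and y :: real
      by (simp add: norm_power norm_mult mult.commute)
    \<comment> \<open>All partial sums of the exponential series are dominated by the series of absolute values.\<close>
    have dom: "cmod (?s n y) \<le> ?w y" for n y
    proof -
      have "cmod (\<Sum>k<n. (\<i> * of_real y * z) ^ k /\<^sub>R fact k) \<le> exp (cmod z * \<bar>y\<bar>)"
        by (rule order_trans[OF norm_sum]) (simp only: termb part)
      then show ?thesis by (simp only: norm_mult mult_left_mono norm_ge_zero)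
    qed
    have "(\<lambda>n. CLINT y|lborel. ?s n y) \<longlonglongrightarrow> (CLINT y|lborel. K y * exp (\<i> * of_real y * z))"
    proof (rule integral_dominated_convergence[where w = ?w])
      show "AE y in lborel. (\<lambda>n. ?s n y) \<longlonglongrightarrow> K y * exp (\<i> * of_real y * z)"
        using exp_converges unfolding sums_def by (intro AE_I2 tendsto_mult tendsto_const)
      show "integrable lborel ?w" by (rule int) simp
      show "AE y in lborel. cmod (?s n y) \<le> ?w y" for n by (intro AE_I2 dom)
    qed auto
    moreover have "(CLINT y|lborel. ?s n y) = (\<Sum>k<n. a k * (z - 0) ^ k)" for n
    proof -
      have int1: "integrable lborel (\<lambda>y. K y * ((\<i> * of_real y) ^ k / fact k) * z ^ k)" for k
      proof (rule Bochner_Integration.integrable_bound[OF int[of "cmod z"]])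
        have "cmod (K y * ((\<i> * of_real y) ^ k / fact k) * z ^ k) \<le> ?w y" for y
        proof -
          have "(cmod z * \<bar>y\<bar>) ^ k /\<^sub>R fact k \<le> (\<Sum>j<Suc k. (cmod z * \<bar>y\<bar>) ^ j /\<^sub>R fact j)"
            by (simp add: sum_nonneg)
          also note part
          finally have "cmod (K y) * ((cmod z * \<bar>y\<bar>) ^ k / fact k) \<le> ?w y"
            by (intro mult_left_mono) (simp_all add: divide_inverse mult.commute)
          then show ?thesis by (simp add: norm_mult norm_divide norm_power power_mult_distrib mult_ac)
        qed
        then show "AE y in lborel. cmod (K y * ((\<i> * of_real y) ^ k / fact k) * z ^ k) \<le> norm (?w y)"
          by (auto intro: order_trans[OF _ abs_ge_self])
      qed auto
      have "?s n y = (\<Sum>k<n. K y * ((\<i> * of_real y) ^ k / fact k) * z ^ k)" for y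
        by (simp add: sum_distrib_left scaleR_conv_of_real power_mult_distrib divide_inverse mult_ac)
      then have "(CLINT y|lborel. ?s n y) = (\<Sum>k<n. CLINT y|lborel. K y * ((\<i> * of_real y) ^ k / fact k) * z ^ k)"
        using int1 by simp
      then show ?thesis by (simp add: a_def)
    qed
    ultimately show ?thesis by (simp add: sums_def)
  qed
  let ?f = "\<lambda>z. CLINT y|lborel. K y * exp (\<i> * of_real y * z)"
  have "?f holomorphic_on ball 0 r" for r
    by (rule power_series_holomorphic[of _ _ a]) (rule sums)
  from holomorphic_on_imp_differentiable_at[OF this open_ball]
  have "?f field_differentiable at z" for z
    by this (rule mem_ball_0[THEN iffD2, OF less_add_one])
  then show ?thesis
    unfolding holomorphic_on_def by (blast intro: field_differentiable_at_within)
qed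

lemma integrable_pair_dominated:
  fixes f :: "real \<Rightarrow> real \<Rightarrow> complex"
  assumes m: "(\<lambda>(x, y). f x y) \<in> borel_measurable (borel \<Otimes>\<^sub>M borel)"
    and ab: "integrable lborel a" "integrable lborel b"
    and le: "\<And>x y. cmod (f x y) \<le> a x * b y"
  shows "integrable (lborel \<Otimes>\<^sub>M lborel) (\<lambda>(x, y). f x y)"
proof (rule Bochner_Integration.integrable_bound)
  have [measurable]: "a \<in> borel_measurable borel" "b \<in> borel_measurable borel" using ab by auto
  show "integrable (lborel \<Otimes>\<^sub>M lborel) (\<lambda>(x, y). a x * b y :: real)"
    by (rule lborel_pair.Fubini_integrable) (use ab in \<open>auto simp: abs_mult\<close>)
  show "(\<lambda>(x, y). f x y) \<in> borel_measurable (lborel \<Otimes>\<^sub>M lborel)" using m by simp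
  show "AE p in lborel \<Otimes>\<^sub>M lborel. norm (case p of (x, y) \<Rightarrow> f x y) \<le> norm (case p of (x, y) \<Rightarrow> a x * b y)"
    using le by (intro AE_I2) (auto intro: order_trans[OF _ abs_ge_self])
qed

section \<open>Beurling's uniqueness theorem\<close>

text \<open>
  Convolving with a Gaussian costs a factor $e^{y^2/2}$ against the weight $e^{|xy|}$. This is exactly the
  factor by which the Fourier transform of the convolution is damped, so that the hypothesis of Beurling's
  theorem is stable under Gaussian regularization.
\<close>
lemma gaussian_weight_shift:
  "(\<integral>\<^sup>+x. ennreal (exp (- (x - t)\<^sup>2 / 2) * exp (\<bar>x\<bar> * \<bar>y\<bar>)) \<partial>lborel)
     \<le> ennreal (2 * sqrt (2 * pi) * exp (y\<^sup>2 / 2) * exp \<bar>t * y\<bar>)"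
proof -
  have "(\<integral>\<^sup>+x. ennreal (exp (- (x - t)\<^sup>2 / 2) * exp (\<bar>x\<bar> * \<bar>y\<bar>)) \<partial>lborel)
      = (\<integral>\<^sup>+s. ennreal (exp (- s\<^sup>2 / 2) * exp (\<bar>t + s\<bar> * \<bar>y\<bar>)) \<partial>lborel)"
    by (subst nn_integral_real_affine[where c = 1 and t = t]) simp_all
  also have "\<dots> \<le> (\<integral>\<^sup>+s. ennreal (exp (- s\<^sup>2 / 2 + \<bar>y\<bar> * \<bar>s\<bar>) * exp \<bar>t * y\<bar>) \<partial>lborel)"
  proof (intro nn_integral_mono ennreal_leI)
    fix s :: real
    have "\<bar>t + s\<bar> * \<bar>y\<bar> \<le> (\<bar>t\<bar> + \<bar>s\<bar>) * \<bar>y\<bar>" by (intro mult_right_mono) auto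
    then have "exp (- s\<^sup>2 / 2 + \<bar>t + s\<bar> * \<bar>y\<bar>) \<le> exp (- s\<^sup>2 / 2 + \<bar>y\<bar> * \<bar>s\<bar> + \<bar>t * y\<bar>)"
      by (simp add: abs_mult algebra_simps)
    then show "exp (- s\<^sup>2 / 2) * exp (\<bar>t + s\<bar> * \<bar>y\<bar>) \<le> exp (- s\<^sup>2 / 2 + \<bar>y\<bar> * \<bar>s\<bar>) * exp \<bar>t * y\<bar>"
      by (simp only: exp_add)
  qed
  also have "\<dots> = ennreal ((LINT s|lborel. exp (- s\<^sup>2 / 2 + \<bar>y\<bar> * \<bar>s\<bar>)) * exp \<bar>t * y\<bar>)"
    using gaussian_abs_integral(1)[of "\<bar>y\<bar>"]
    by (subst nn_integral_eq_integral) auto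
  also have "\<dots> \<le> ennreal (2 * sqrt (2 * pi) * exp (y\<^sup>2 / 2) * exp \<bar>t * y\<bar>)"
    using gaussian_abs_integral(2)[of "\<bar>y\<bar>"] by (intro ennreal_leI mult_right_mono) auto
  finally show ?thesis .
qed

text \<open>
  Beurling's uniqueness theorem, with the conclusion stated for the Fourier transform. Instead of $h$ the
  proof treats its convolution with a Gaussian, whose transform is $K(y) = H(y)e^{-y^2/2}$ up to a constant.
  The regularized function extends to an entire function $G$. Since $H$ is bounded,
  $|G(z)| \le M(|{\rm Im}\, z|)$ where $M(t) = \int |K(y)| e^{t|y|}\,dy$ grows at most like $e^{t^2/2}$,
  and the weighted integral stays finite by \<open>gaussian_weight_shift\<close>. Hence $G = 0$, and as the
  transform of $G$ on the real line is $H$ times a positive function, $H = 0$.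
\<close>
theorem beurling:
  fixes h :: "real \<Rightarrow> complex"
  defines "H \<equiv> \<lambda>y. CLINT t|lborel. h t * iexp (- (t * y))"
  assumes h: "integrable lborel h"
    and fin: "(\<integral>\<^sup>+t. \<integral>\<^sup>+y. ennreal (cmod (h t) * cmod (H y) * exp \<bar>t * y\<bar>) \<partial>lborel \<partial>lborel) < \<infinity>"
  shows "H y = 0"
proof -
  have hm [measurable]: "h \<in> borel_measurable borel" using h by auto
  have Hm [measurable]: "H \<in> borel_measurable borel" unfolding H_def by measurable
  define L where "L = (LINT t|lborel. cmod (h t))"
  have Hle: "cmod (H y) \<le> L" for y
    unfolding H_def L_def by (rule order_trans[OF integral_norm_bound]) (simp add: norm_mult)
  define K where "K y = H y * of_real (exp (- y\<^sup>2 / 2))" for y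
  have Km [measurable]: "K \<in> borel_measurable borel" unfolding K_def by measurable
  have Kle: "cmod (K y) * exp (t * \<bar>y\<bar>) \<le> L * exp (- y\<^sup>2 / 2 + t * \<bar>y\<bar>)" for y t
  proof -
    have "cmod (K y) * exp (t * \<bar>y\<bar>) = cmod (H y) * exp (- y\<^sup>2 / 2 + t * \<bar>y\<bar>)"
      by (simp only: K_def norm_mult norm_of_real abs_exp_cancel exp_add mult.assoc)
    then show ?thesis by (simp only: mult_right_mono Hle exp_ge_zero)
  qed
  have Kint: "integrable lborel (\<lambda>y. cmod (K y) * exp (t * \<bar>y\<bar>))" for t
    by (rule Bochner_Integration.integrable_bound[OF integrable_mult_right[OF gaussian_abs_integral(1)[of t], of L]])
      (use Kle in \<open>auto intro: order_trans[OF _ abs_ge_self]\<close>)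
  define M where "M t = (LINT y|lborel. cmod (K y) * exp (t * \<bar>y\<bar>))" for t
  define G where "G = (\<lambda>z. CLINT y|lborel. K y * exp (\<i> * of_real y * z))"
  have holG: "G holomorphic_on UNIV"
    unfolding G_def by (rule fourier_laplace_entire[OF Km Kint])
  have GM: "cmod (G z) \<le> M \<bar>Im z\<bar>" for z
  proof -
    have *: "cmod (K y * exp (\<i> * of_real y * z)) \<le> cmod (K y) * exp (\<bar>Im z\<bar> * \<bar>y\<bar>)" for y
      unfolding norm_mult norm_exp_eq_Re
      by (intro mult_left_mono) (auto simp: abs_mult[symmetric] mult.commute abs_le_iff intro: order_trans[OF abs_ge_minus_self])
    have "cmod (G z) \<le> (LINT y|lborel. cmod (K y * exp (\<i> * of_real y * z)))"
      unfolding G_def by (rule integral_norm_bound)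
    also have "\<dots> \<le> M \<bar>Im z\<bar>"
      unfolding M_def
      by (intro integral_mono Kint * Bochner_Integration.integrable_bound[OF Kint[of "\<bar>Im z\<bar>"]])
        (use * in \<open>auto intro: order_trans[OF _ abs_ge_self]\<close>)
    finally show ?thesis .
  qed
  have mono: "M s \<le> M t" if "0 \<le> s" "s \<le> t" for s t
    unfolding M_def using that
    by (intro integral_mono Kint mult_left_mono) (auto intro: mult_right_mono)
  have growth: "M t \<le> (L * (2 * sqrt (2 * pi))) * exp (1 / 2 * t\<^sup>2)" if "0 \<le> t" for t
  proof -
    have "M t \<le> (LINT y|lborel. L * exp (- y\<^sup>2 / 2 + t * \<bar>y\<bar>))"
      unfolding M_def by (intro integral_mono Kint Kle integrable_mult_right gaussian_abs_integral)
    also have "\<dots> \<le> L * (2 * sqrt (2 * pi) * exp (t\<^sup>2 / 2))"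
      unfolding integral_mult_right_zero
      by (intro mult_left_mono gaussian_abs_integral) (simp add: L_def)
    finally show ?thesis by (simp add: mult.assoc)
  qed
  \<comment> \<open>On the real line \<open>G\<close> is the convolution of \<open>h\<close> with a Gaussian.\<close>
  have Greal: "G (of_real x) = of_real (sqrt (2 * pi)) * (CLINT t|lborel. h t * of_real (exp (- (x - t)\<^sup>2 / 2)))" for x
  proof -
    let ?f = "\<lambda>t y. h t * (of_real (exp (- y\<^sup>2 / 2)) * iexp ((x - t) * y))"
    have int: "integrable (lborel \<Otimes>\<^sub>M lborel) (\<lambda>(t, y). ?f t y)"
      by (rule integrable_pair_dominated[of _ "\<lambda>t. cmod (h t)" "\<lambda>y. exp (- y\<^sup>2 / 2)"])
        (use h gaussian_abs_integral(1)[of 0] in \<open>auto simp: norm_mult\<close>)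
    have "G (of_real x) = (CLINT y|lborel. CLINT t|lborel. ?f t y)"
      unfolding G_def K_def H_def
    proof (intro Bochner_Integration.integral_cong refl)
      fix y :: real
      have "(CLINT t|lborel. h t * iexp (- (t * y))) * of_real (exp (- y\<^sup>2 / 2)) * exp (\<i> * of_real y * of_real x)
        = (CLINT t|lborel. h t * iexp (- (t * y)) * (of_real (exp (- y\<^sup>2 / 2)) * iexp (x * y)))"
      proof -
        have "exp (\<i> * of_real y * of_real x) = iexp (x * y)" by (simp add: mult_ac)
        then show ?thesis by (subst integral_mult_left_zero) (simp only: mult.assoc)
      qed
      also have "\<dots> = (CLINT t|lborel. ?f t y)"
        by (intro Bochner_Integration.integral_cong refl) (simp add: mult_ac exp_add[symmetric] algebra_simps)
      finally show "(CLINT t|lborel. h t * iexp (- (t * y))) * of_real (exp (- y\<^sup>2 / 2)) * exp (\<i> * of_real y * of_real x) = \<dots>" .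
    qed
    also have "\<dots> = (CLINT t|lborel. CLINT y|lborel. ?f t y)"
      by (rule lborel_pair.Fubini_integral[OF int])
    also have "\<dots> = (CLINT t|lborel. h t * of_real (sqrt (2 * pi) * exp (- (x - t)\<^sup>2 / 2)))"
      by (simp only: integral_mult_right_zero gaussian_fourier_integral)
    also have "\<dots> = (CLINT t|lborel. of_real (sqrt (2 * pi)) * (h t * of_real (exp (- (x - t)\<^sup>2 / 2))))"
      by (intro Bochner_Integration.integral_cong refl) (simp add: mult_ac)
    finally show ?thesis by simp
  qed
  have GL: "cmod (G (of_real x)) \<le> sqrt (2 * pi) * (LINT t|lborel. cmod (h t) * exp (- (x - t)\<^sup>2 / 2))" for x
    unfolding Greal norm_mult
    by (intro mult_mono order_trans[OF integral_norm_bound]) (auto simp: norm_mult)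
  have hg: "integrable lborel (\<lambda>t. cmod (h t) * exp (- (x - t)\<^sup>2 / 2))" for x
    by (rule Bochner_Integration.integrable_bound[OF integrable_norm[OF h]]) (auto simp: mult_left_le)
  have "(\<integral>\<^sup>+x. ennreal (cmod (G (of_real x)) * M \<bar>x\<bar>) \<partial>lborel)
      \<le> (\<integral>\<^sup>+x. \<integral>\<^sup>+t. \<integral>\<^sup>+y. ennreal (sqrt (2 * pi)) * (ennreal (cmod (h t)) * ennreal (cmod (K y)) *
            ennreal (exp (- (x - t)\<^sup>2 / 2) * exp (\<bar>x\<bar> * \<bar>y\<bar>))) \<partial>lborel \<partial>lborel \<partial>lborel)"
  proof (intro nn_integral_mono)
    fix x :: real
    have M0: "0 \<le> M \<bar>x\<bar>" unfolding M_def by simp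
    define A where "A = (LINT t|lborel. cmod (h t) * exp (- (x - t)\<^sup>2 / 2))"
    have A0: "0 \<le> A" unfolding A_def by simp
    have A: "(\<integral>\<^sup>+t. ennreal (cmod (h t) * exp (- (x - t)\<^sup>2 / 2)) \<partial>lborel) = ennreal A"
      unfolding A_def by (rule nn_integral_eq_integral[OF hg]) simp
    have Mx: "(\<integral>\<^sup>+y. ennreal (cmod (K y) * exp (\<bar>x\<bar> * \<bar>y\<bar>)) \<partial>lborel) = ennreal (M \<bar>x\<bar>)"
      unfolding M_def by (rule nn_integral_eq_integral[OF Kint]) simp
    have "ennreal (cmod (G (of_real x)) * M \<bar>x\<bar>) \<le> ennreal (sqrt (2 * pi) * A * M \<bar>x\<bar>)"
      unfolding A_def by (intro ennreal_leI mult_right_mono GL M0)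
    also have "\<dots> = ennreal (sqrt (2 * pi)) * ((\<integral>\<^sup>+t. ennreal (cmod (h t) * exp (- (x - t)\<^sup>2 / 2)) \<partial>lborel) * (\<integral>\<^sup>+y. ennreal (cmod (K y) * exp (\<bar>x\<bar> * \<bar>y\<bar>)) \<partial>lborel))"
      unfolding A Mx using A0 M0 by (simp add: ennreal_mult mult.assoc)
    also have "\<dots> = (\<integral>\<^sup>+t. \<integral>\<^sup>+y. ennreal (sqrt (2 * pi)) * (ennreal (cmod (h t) * exp (- (x - t)\<^sup>2 / 2)) * ennreal (cmod (K y) * exp (\<bar>x\<bar> * \<bar>y\<bar>))) \<partial>lborel \<partial>lborel)"
      by (simp add: nn_integral_cmult nn_integral_multc)
    also have "\<dots> = (\<integral>\<^sup>+t. \<integral>\<^sup>+y. ennreal (sqrt (2 * pi)) * (ennreal (cmod (h t)) * ennreal (cmod (K y)) *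
            ennreal (exp (- (x - t)\<^sup>2 / 2) * exp (\<bar>x\<bar> * \<bar>y\<bar>))) \<partial>lborel \<partial>lborel)"
      by (simp add: ennreal_mult mult_ac)
    finally show "ennreal (cmod (G (of_real x)) * M \<bar>x\<bar>) \<le> \<dots>" .
  qed
  also have "\<dots> = (\<integral>\<^sup>+t. \<integral>\<^sup>+x. \<integral>\<^sup>+y. ennreal (sqrt (2 * pi)) * (ennreal (cmod (h t)) * ennreal (cmod (K y)) *
            ennreal (exp (- (x - t)\<^sup>2 / 2) * exp (\<bar>x\<bar> * \<bar>y\<bar>))) \<partial>lborel \<partial>lborel \<partial>lborel)"
    by (rule lborel_pair.Fubini') measurable
  also have "\<dots> = (\<integral>\<^sup>+t. \<integral>\<^sup>+y. \<integral>\<^sup>+x. ennreal (sqrt (2 * pi)) * (ennreal (cmod (h t)) * ennreal (cmod (K y)) *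
            ennreal (exp (- (x - t)\<^sup>2 / 2) * exp (\<bar>x\<bar> * \<bar>y\<bar>))) \<partial>lborel \<partial>lborel \<partial>lborel)"
    by (intro nn_integral_cong lborel_pair.Fubini') measurable
  also have "\<dots> \<le> (\<integral>\<^sup>+t. \<integral>\<^sup>+y. ennreal (4 * pi) * ennreal (cmod (h t) * cmod (H y) * exp \<bar>t * y\<bar>) \<partial>lborel \<partial>lborel)"
  proof (intro nn_integral_mono)
    fix t y :: real
    have "(\<integral>\<^sup>+x. ennreal (sqrt (2 * pi)) * (ennreal (cmod (h t)) * ennreal (cmod (K y)) *
            ennreal (exp (- (x - t)\<^sup>2 / 2) * exp (\<bar>x\<bar> * \<bar>y\<bar>))) \<partial>lborel)
      = ennreal (sqrt (2 * pi)) * (ennreal (cmod (h t)) * ennreal (cmod (K y)) * 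
            (\<integral>\<^sup>+x. ennreal (exp (- (x - t)\<^sup>2 / 2) * exp (\<bar>x\<bar> * \<bar>y\<bar>)) \<partial>lborel))"
      by (simp add: nn_integral_cmult)
    also have "\<dots> \<le> ennreal (sqrt (2 * pi)) * (ennreal (cmod (h t)) * ennreal (cmod (K y)) * 
            ennreal (2 * sqrt (2 * pi) * exp (y\<^sup>2 / 2) * exp \<bar>t * y\<bar>))"
      by (intro mult_left_mono gaussian_weight_shift) auto
    also have "\<dots> = ennreal (sqrt (2 * pi) * (cmod (h t) * cmod (K y) * (2 * sqrt (2 * pi) * exp (y\<^sup>2 / 2) * exp \<bar>t * y\<bar>)))"
      by (simp add: ennreal_mult)
    also have "sqrt (2 * pi) * (cmod (h t) * cmod (K y) * (2 * sqrt (2 * pi) * exp (y\<^sup>2 / 2) * exp \<bar>t * y\<bar>))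
       = (2 * (sqrt (2 * pi) * sqrt (2 * pi))) * (exp (- y\<^sup>2 / 2) * exp (y\<^sup>2 / 2)) * (cmod (h t) * cmod (H y) * exp \<bar>t * y\<bar>)"
      by (simp add: K_def norm_mult mult_ac)
    also have "\<dots> = 4 * pi * (cmod (h t) * cmod (H y) * exp \<bar>t * y\<bar>)"
      by (simp flip: exp_add)
    finally show "(\<integral>\<^sup>+x. ennreal (sqrt (2 * pi)) * (ennreal (cmod (h t)) * ennreal (cmod (K y)) *
            ennreal (exp (- (x - t)\<^sup>2 / 2) * exp (\<bar>x\<bar> * \<bar>y\<bar>))) \<partial>lborel)
      \<le> ennreal (4 * pi) * ennreal (cmod (h t) * cmod (H y) * exp \<bar>t * y\<bar>)"
      by (simp add: ennreal_mult)
  qed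
  also have "\<dots> = ennreal (4 * pi) * (\<integral>\<^sup>+t. \<integral>\<^sup>+y. ennreal (cmod (h t) * cmod (H y) * exp \<bar>t * y\<bar>) \<partial>lborel \<partial>lborel)"
    by (simp add: nn_integral_cmult)
  also have "\<dots> < \<infinity>" using fin by (simp add: ennreal_mult_less_top)
  finally have int: "(\<integral>\<^sup>+x. ennreal (cmod (G (of_real x)) * M \<bar>x\<bar>) \<partial>lborel) < \<infinity>" .
  have G0: "G z = 0" for z
    by (rule hormander_entire_vanishes[OF holG GM mono growth int])
  let ?g = "\<lambda>t x. h t * iexp (- (t * y)) * (of_real (exp (- (x - t)\<^sup>2 / 2)) * iexp (- ((x - t) * y)))"
  have "integrable (lborel \<Otimes>\<^sub>M lborel) (\<lambda>(t, s). h t * iexp (- (t * y)) * (of_real (exp (- s\<^sup>2 / 2)) * iexp (- (s * y))))"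
    by (rule integrable_pair_dominated[of _ "\<lambda>t. cmod (h t)" "\<lambda>y. exp (- y\<^sup>2 / 2)"])
      (use h gaussian_abs_integral(1)[of 0] in \<open>auto simp: norm_mult\<close>)
  have gint: "integrable (lborel \<Otimes>\<^sub>M lborel) (\<lambda>(t, x). ?g t x)"
  proof (rule lborel_pair.Fubini_integrable)
    have sh: "(LINT x|lborel. exp (- (x - t)\<^sup>2 / 2)) = (LINT x|lborel. exp (- x\<^sup>2 / 2))" 
             "integrable lborel (\<lambda>x. exp (- (x - t)\<^sup>2 / 2))" for t :: real
      using lborel_integral_real_affine[of 1 "\<lambda>x. exp (- (x - t)\<^sup>2 / 2)" t]
        lborel_integrable_real_affine[of "\<lambda>x. exp (- x\<^sup>2 / 2)" 1 "- t"] gaussian_abs_integral(1)[of 0]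
      by (simp_all add: algebra_simps)
    show "integrable lborel (\<lambda>t. LINT x|lborel. cmod (case (t, x) of (t, x) \<Rightarrow> ?g t x))"
    proof -
      have "cmod (?g t x) = cmod (h t) * exp (- (x - t)\<^sup>2 / 2)" for t x by (simp add: norm_mult)
      then show ?thesis
        unfolding prod.case by (simp only: integral_mult_right_zero sh(1) integrable_mult_left integrable_norm h)
    qed
    show "AE t in lborel. integrable lborel (\<lambda>x. case (t, x) of (t, x) \<Rightarrow> ?g t x)"
      by (intro AE_I2) (simp, intro integrable_mult_right Bochner_Integration.integrable_bound[OF sh(2)], auto simp: norm_mult)
  qed measurable
  have inner: "(CLINT x|lborel. of_real (exp (- (x - t)\<^sup>2 / 2)) * iexp (- ((x - t) * y))) = of_real (sqrt (2 * pi) * exp (- y\<^sup>2 / 2))" for t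
    using lborel_integral_real_affine[of 1 "\<lambda>x. of_real (exp (- (x - t)\<^sup>2 / 2)) * iexp (- ((x - t) * y))" t]
      gaussian_fourier_integral[of "- y"] by (simp add: mult.commute)
  \<comment> \<open>Transforming the vanishing convolution back exhibits the factor \<open>H y\<close>.\<close>
  have "0 = (CLINT x|lborel. iexp (- (x * y)) * G (of_real x))" by (simp add: G0)
  also have "\<dots> = (CLINT x|lborel. of_real (sqrt (2 * pi)) * (CLINT t|lborel. ?g t x))"
  proof (intro Bochner_Integration.integral_cong refl)
    fix x :: real
    have "iexp (- (x * y)) * (CLINT t|lborel. h t * of_real (exp (- (x - t)\<^sup>2 / 2)))
        = (CLINT t|lborel. iexp (- (x * y)) * (h t * of_real (exp (- (x - t)\<^sup>2 / 2))))"
      by simp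
    also have "\<dots> = (CLINT t|lborel. ?g t x)"
      by (intro Bochner_Integration.integral_cong refl) (simp add: mult_ac exp_add[symmetric] algebra_simps)
    finally show "iexp (- (x * y)) * G (of_real x) = of_real (sqrt (2 * pi)) * (CLINT t|lborel. ?g t x)"
      unfolding Greal by (simp add: mult_ac)
  qed
  also have "\<dots> = of_real (sqrt (2 * pi)) * (CLINT x|lborel. CLINT t|lborel. ?g t x)"
    by (rule integral_mult_right_zero)
  also have "(CLINT x|lborel. CLINT t|lborel. ?g t x) = (CLINT t|lborel. CLINT x|lborel. ?g t x)"
    by (rule lborel_pair.Fubini_integral[OF gint])
  also have "\<dots> = H y * of_real (sqrt (2 * pi) * exp (- y\<^sup>2 / 2))"
    unfolding integral_mult_right_zero inner integral_mult_left_zero H_def by simp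
  finally show ?thesis by simp
qed

section \<open>Injectivity of the Fourier transform\<close>

text \<open>
  The case $y = 0$ shows that the masses agree. If they are not zero, then after normalization $p$ and $q$ are probability densities
  with the same characteristic function, and Levy's uniqueness theorem applies.
\<close>
lemma fourier_injective_nonneg:
  fixes p q :: "real \<Rightarrow> real"
  assumes int: "integrable lborel p" "integrable lborel q"
    and nonneg: "\<And>t. 0 \<le> p t" "\<And>t. 0 \<le> q t"
    and eq: "\<And>y. (CLINT t|lborel. p t *\<^sub>R iexp (y * t)) = (CLINT t|lborel. q t *\<^sub>R iexp (y * t))"
  shows "AE t in lborel. p t = q t"
proof -
  have [measurable]: "p \<in> borel_measurable borel" "q \<in> borel_measurable borel" using int by auto
  define c where "c = (LINT t|lborel. p t)"
  have "complex_of_real (LINT t|lborel. p t) = complex_of_real (LINT t|lborel. q t)"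
    using eq[of 0] by (simp add: scaleR_conv_of_real)
  then have cq: "c = (LINT t|lborel. q t)" by (simp add: c_def)
  have c0: "0 \<le> c" unfolding c_def using nonneg by (intro Bochner_Integration.integral_nonneg) auto
  show ?thesis
  proof (cases "c = 0")
    case True
    then have "AE t in lborel. p t = 0" "AE t in lborel. q t = 0"
      using integral_nonneg_eq_0_iff_AE[OF int(1)] integral_nonneg_eq_0_iff_AE[OF int(2)] nonneg cq
      by (simp_all add: c_def)
    then show ?thesis by eventually_elim simp
  next
    case False
    then have c: "c > 0" using c0 by simp
    let ?D = "\<lambda>p. density lborel (\<lambda>t. ennreal (p t / c))"
    have rd: "real_distribution (?D g)" if g: "integrable lborel g" "\<And>t. 0 \<le> g t" "(LINT t|lborel. g t) = c" for g
    proof -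
      have [measurable]: "g \<in> borel_measurable borel" using g by auto
      have "prob_space (?D g)"
      proof
        have "emeasure (?D g) (space (?D g)) = (\<integral>\<^sup>+t. ennreal (g t / c) \<partial>lborel)"
          by (simp add: emeasure_density)
        also have "\<dots> = ennreal (LINT t|lborel. g t / c)"
          using g c by (intro nn_integral_eq_integral) auto
        finally show "emeasure (?D g) (space (?D g)) = 1" using g c by simp
      qed
      then show ?thesis by (simp add: real_distribution_def real_distribution_axioms_def)
    qed
    have ch: "char (?D g) y = (1 / c) *\<^sub>R (CLINT t|lborel. g t *\<^sub>R iexp (y * t))" 
      if "integrable lborel g" "\<And>t. 0 \<le> g t" for g y
    proof -
      have [measurable]: "g \<in> borel_measurable borel" using that by auto
      have "char (?D g) y = (CLINT t|lborel. (g t / c) *\<^sub>R iexp (y * t))"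
        unfolding char_def using that c by (subst integral_density) auto
      also have "\<dots> = (CLINT t|lborel. (1 / c) *\<^sub>R (g t *\<^sub>R iexp (y * t)))" by simp
      finally show ?thesis by (simp only: integral_scaleR_right)
    qed
    have "char (?D p) = char (?D q)"
      using ch int nonneg eq by (intro ext) simp
    then have "?D p = ?D q"
      using rd[of p] rd[of q] int nonneg cq c_def by (intro Levy_uniqueness) auto
    then have "AE t in lborel. ennreal (p t / c) = ennreal (q t / c)"
      by (intro sigma_finite_measure.density_unique[OF sigma_finite_lborel]) auto
    then show ?thesis
      by eventually_elim (use nonneg c in \<open>simp add: ennreal_inj\<close>)
  qed
qed

lemma fourier_injective_real:
  fixes g :: "real \<Rightarrow> real"
  assumes g: "integrable lborel g"
    and zero: "\<And>y. (CLINT t|lborel. g t *\<^sub>R iexp (y * t)) = 0"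
  shows "AE t in lborel. g t = 0"
proof -
  have [measurable]: "g \<in> borel_measurable borel" using g by auto
  let ?p = "\<lambda>t. max 0 (g t)" and ?q = "\<lambda>t. max 0 (- g t)"
  have int: "integrable lborel ?p" "integrable lborel ?q" using g by auto
  have intc: "complex_integrable lborel (\<lambda>t. u t *\<^sub>R iexp (y * t))" if "integrable lborel u" for u y
  proof -
    have [measurable]: "u \<in> borel_measurable borel" using that by auto
    show ?thesis by (rule Bochner_Integration.integrable_bound[OF that]) auto
  qed
  have "AE t in lborel. ?p t = ?q t"
  proof (rule fourier_injective_nonneg[OF int])
    fix y
    have "(CLINT t|lborel. ?p t *\<^sub>R iexp (y * t)) - (CLINT t|lborel. ?q t *\<^sub>R iexp (y * t))
        = (CLINT t|lborel. ?p t *\<^sub>R iexp (y * t) - ?q t *\<^sub>R iexp (y * t))"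
      by (rule Bochner_Integration.integral_diff[symmetric]) (intro intc int)+
    also have "\<dots> = (CLINT t|lborel. g t *\<^sub>R iexp (y * t))"
      by (intro Bochner_Integration.integral_cong refl) (simp add: max_def)
    finally show "(CLINT t|lborel. ?p t *\<^sub>R iexp (y * t)) = (CLINT t|lborel. ?q t *\<^sub>R iexp (y * t))"
      using zero by simp
  qed auto
  then show ?thesis by eventually_elim (auto simp: max_def split: if_splits)
qed

lemma fourier_injective:
  fixes h :: "real \<Rightarrow> complex"
  assumes h: "integrable lborel h"
    and zero: "\<And>y. (CLINT t|lborel. h t * iexp (- (t * y))) = 0"
  shows "AE t in lborel. h t = 0"
proof -
  have [measurable]: "h \<in> borel_measurable borel" using h by auto
  have [measurable]: "(\<lambda>t. cnj (h t)) \<in> borel_measurable borel"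
    using borel_measurable_integrable[OF integrable_cnj[OF h]] by simp
  have int: "complex_integrable lborel (\<lambda>t. h t * iexp (y * t))" 
    "complex_integrable lborel (\<lambda>t. cnj (h t) * iexp (y * t))" for y
    by (rule Bochner_Integration.integrable_bound[OF h]; simp add: norm_mult)+
  have z1: "(CLINT t|lborel. h t * iexp (y * t)) = 0" for y
    using zero[of "- y"] by (simp add: mult.commute)
  have z2: "(CLINT t|lborel. cnj (h t) * iexp (y * t)) = 0" for y
  proof -
    have "(CLINT t|lborel. cnj (h t) * iexp (y * t)) = (CLINT t|lborel. cnj (h t * iexp (- (t * y))))"
      by (simp add: exp_cnj mult.commute)
    also have "\<dots> = cnj (CLINT t|lborel. h t * iexp (- (t * y)))"
      by (rule Bochner_Integration.integral_cnj)
    finally show ?thesis by (simp only: zero complex_cnj_zero)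
  qed
  have "AE t in lborel. Re (h t) = 0"
  proof (rule fourier_injective_real)
    fix y
    have "(CLINT t|lborel. Re (h t) *\<^sub>R iexp (y * t)) = (CLINT t|lborel. (h t * iexp (y * t) + cnj (h t) * iexp (y * t)) / 2)"
      by (intro Bochner_Integration.integral_cong refl)
        (simp add: scaleR_conv_of_real complex_add_cnj distrib_right[symmetric])
    then show "(CLINT t|lborel. Re (h t) *\<^sub>R iexp (y * t)) = 0"
      using int z1 z2 by simp
  qed (use h in auto)
  moreover have "AE t in lborel. Im (h t) = 0"
  proof (rule fourier_injective_real)
    fix y
    have "(CLINT t|lborel. Im (h t) *\<^sub>R iexp (y * t)) = (CLINT t|lborel. (h t * iexp (y * t) - cnj (h t) * iexp (y * t)) / (2 * \<i>))"
    proof (intro Bochner_Integration.integral_cong refl)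
      fix t
      have Im: "of_real (Im z) = (z - cnj z) / (2 * \<i>)" for z by (simp add: complex_diff_cnj complex_eq_iff)
      show "Im (h t) *\<^sub>R iexp (y * t) = (h t * iexp (y * t) - cnj (h t) * iexp (y * t)) / (2 * \<i>)"
        unfolding scaleR_conv_of_real Im by (simp only: left_diff_distrib times_divide_eq_left)
    qed
    then show "(CLINT t|lborel. Im (h t) *\<^sub>R iexp (y * t)) = 0"
      using int z1 z2 by simp
  qed (use h in auto)
  ultimately show ?thesis by eventually_elim (simp add: complex_eq_iff)
qed

lemma fourier_continuous:
  fixes h :: "real \<Rightarrow> complex"
  assumes h: "integrable lborel h"
  shows "continuous_on UNIV (\<lambda>y. CLINT t|lborel. h t * iexp (- (t * y)))"
proof -
  have [measurable]: "h \<in> borel_measurable borel" using h by auto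
  have "(\<lambda>n. CLINT t|lborel. h t * iexp (- (t * x n))) \<longlonglongrightarrow> (CLINT t|lborel. h t * iexp (- (t * y)))"
    if "x \<longlonglongrightarrow> y" for x y
  proof (rule integral_dominated_convergence[where w = "\<lambda>t. cmod (h t)"])
    show "AE t in lborel. (\<lambda>n. h t * iexp (- (t * x n))) \<longlonglongrightarrow> h t * iexp (- (t * y))"
      by (intro AE_I2 tendsto_intros that)
  qed (use h in \<open>auto simp: norm_mult\<close>)
  then show ?thesis
    by (auto simp: continuous_on_sequentially o_def)
qed

section \<open>Averaging over window positions\<close>

lemma norm_mult_le_sum_squares:
  fixes x y :: complex
  shows "cmod x * cmod y \<le> (cmod x)\<^sup>2 + (cmod y)\<^sup>2"
proof -
  have "2 * (cmod x * cmod y) \<le> (cmod x)\<^sup>2 + (cmod y)\<^sup>2"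
    using sum_squares_bound[of "cmod x" "cmod y"] by (simp add: mult.assoc)
  then show ?thesis
    using mult_nonneg_nonneg[OF norm_ge_zero[of x] norm_ge_zero[of y]] by linarith
qed

text \<open>
  The set of window positions has finite measure, and for a fixed position the product is
  integrable with a bound independent of the position. This justifies all exchanges of integrals below.
\<close>
lemma windowed_fubini_integrable:
  fixes f \<psi> :: "real \<Rightarrow> complex"
  assumes [measurable]: "f \<in> borel_measurable borel" "\<psi> \<in> borel_measurable borel" "S \<in> sets borel"
    and sq: "integrable lborel (\<lambda>t. (cmod (f t))\<^sup>2)" "integrable lborel (\<lambda>t. (cmod (\<psi> t))\<^sup>2)"
    and S: "emeasure lborel S < \<infinity>"
  shows "integrable (lborel \<Otimes>\<^sub>M lborel) (\<lambda>(w, t). indicator S w *\<^sub>R (f t * \<psi> (t - w)))"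
proof (rule integrableI_bounded)
  let ?C = "(\<integral>\<^sup>+t. ennreal ((cmod (f t))\<^sup>2) \<partial>lborel) + (\<integral>\<^sup>+t. ennreal ((cmod (\<psi> t))\<^sup>2) \<partial>lborel)"
  have C: "?C < \<infinity>"
    using sq by (simp add: integrable_iff_bounded)
  have "(\<integral>\<^sup>+p. ennreal (norm (case p of (w, t) \<Rightarrow> indicator S w *\<^sub>R (f t * \<psi> (t - w)))) \<partial>(lborel \<Otimes>\<^sub>M lborel))
      = (\<integral>\<^sup>+w. \<integral>\<^sup>+t. ennreal (norm (indicator S w *\<^sub>R (f t * \<psi> (t - w)))) \<partial>lborel \<partial>lborel)"
    by (subst lborel.nn_integral_fst[symmetric]) auto
  also have "\<dots> \<le> (\<integral>\<^sup>+w. ?C * indicator S w \<partial>lborel)"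
  proof (rule nn_integral_mono)
    fix w :: real
    have "(\<integral>\<^sup>+t. ennreal (norm (indicator S w *\<^sub>R (f t * \<psi> (t - w)))) \<partial>lborel)
        \<le> (\<integral>\<^sup>+t. (ennreal ((cmod (f t))\<^sup>2) + ennreal ((cmod (\<psi> (t - w)))\<^sup>2)) * indicator S w \<partial>lborel)"
    proof (rule nn_integral_mono)
      fix t
      have "cmod (f t) * cmod (\<psi> (t - w)) \<le> (cmod (f t))\<^sup>2 + (cmod (\<psi> (t - w)))\<^sup>2"
        by (rule norm_mult_le_sum_squares)
      then show "ennreal (norm (indicator S w *\<^sub>R (f t * \<psi> (t - w)))) \<le> (ennreal ((cmod (f t))\<^sup>2) + ennreal ((cmod (\<psi> (t - w)))\<^sup>2)) * indicator S w"
        by (cases "w \<in> S") (auto simp: norm_mult ennreal_plus[symmetric] simp del: ennreal_plus intro: ennreal_leI)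
    qed
    also have "\<dots> = ((\<integral>\<^sup>+t. ennreal ((cmod (f t))\<^sup>2) \<partial>lborel) + (\<integral>\<^sup>+t. ennreal ((cmod (\<psi> (t - w)))\<^sup>2) \<partial>lborel)) * indicator S w"
      by (simp add: nn_integral_multc nn_integral_add)
    also have "(\<integral>\<^sup>+t. ennreal ((cmod (\<psi> (t - w)))\<^sup>2) \<partial>lborel) = (\<integral>\<^sup>+t. ennreal ((cmod (\<psi> t))\<^sup>2) \<partial>lborel)"
      by (subst nn_integral_real_affine[where c = 1 and t = w]) simp_all
    finally show "(\<integral>\<^sup>+t. ennreal (norm (indicator S w *\<^sub>R (f t * \<psi> (t - w)))) \<partial>lborel) \<le> ?C * indicator S w" .
  qed
  also have "\<dots> = ?C * emeasure lborel S" by (simp add: nn_integral_cmult)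
  also have "\<dots> < \<infinity>" using C S by (simp add: ennreal_mult_less_top)
  finally show "(\<integral>\<^sup>+p. ennreal (norm (case p of (w, t) \<Rightarrow> indicator S w *\<^sub>R (f t * \<psi> (t - w)))) \<partial>(lborel \<Otimes>\<^sub>M lborel)) < \<infinity>" .
qed measurable

lemma windowed_section_integrable:
  fixes f \<psi> :: "real \<Rightarrow> complex"
  assumes [measurable]: "f \<in> borel_measurable borel" "\<psi> \<in> borel_measurable borel"
    and sq: "integrable lborel (\<lambda>t. (cmod (f t))\<^sup>2)" "integrable lborel (\<lambda>t. (cmod (\<psi> t))\<^sup>2)"
  shows "integrable lborel (\<lambda>t. f t * \<psi> (t - w))"
proof (rule Bochner_Integration.integrable_bound)
  show "integrable lborel (\<lambda>t. (cmod (f t))\<^sup>2 + (cmod (\<psi> (t - w)))\<^sup>2)"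
    using lborel_integrable_real_affine[OF sq(2), of 1 "- w"] sq(1) by (simp add: add.commute)
  show "AE t in lborel. norm (f t * \<psi> (t - w)) \<le> norm ((cmod (f t))\<^sup>2 + (cmod (\<psi> (t - w)))\<^sup>2)"
  proof (rule AE_I2)
    fix t
    have "cmod (f t) * cmod (\<psi> (t - w)) \<le> (cmod (f t))\<^sup>2 + (cmod (\<psi> (t - w)))\<^sup>2"
      by (rule norm_mult_le_sum_squares)
    then show "norm (f t * \<psi> (t - w)) \<le> norm ((cmod (f t))\<^sup>2 + (cmod (\<psi> (t - w)))\<^sup>2)"
      by (simp add: norm_mult)
  qed
qed measurable

text \<open>
  For a single position $w$ the hypothesis has the weight $|f(t)|$ where Beurling's theorem for the windowed
  function $f(t)\psi(t-w)$ needs $|f(t)\psi(t-w)|$, and $\psi$ may be unbounded. Averaging over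
  positions $w$ in a set $S$ of finite measure repairs this: the function
  $h(t) = f(t)\int_S \psi(t-w)\,dw$ satisfies $|h| \le C|f|$, because $|\psi| \le 1 + |\psi|^2$, and its
  Fourier transform is the average of the transforms $V(\cdot,w)$. If the weighted integrals are bounded
  uniformly on $S$, then $h$ satisfies the hypothesis of Beurling's theorem.
\<close>
lemma averaged_window_transform_vanishes:
  fixes f \<psi> :: "real \<Rightarrow> complex"
  defines "V \<equiv> \<lambda>y w. CLINT t|lborel. f t * \<psi> (t - w) * iexp (- (t * y))"
  assumes [measurable]: "f \<in> borel_measurable borel" "\<psi> \<in> borel_measurable borel" "S \<in> sets borel"
    and sq: "integrable lborel (\<lambda>t. (cmod (f t))\<^sup>2)" "integrable lborel (\<lambda>t. (cmod (\<psi> t))\<^sup>2)"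
    and S: "emeasure lborel S < \<infinity>"
    and bnd: "\<And>w. w \<in> S \<Longrightarrow> (\<integral>\<^sup>+t. \<integral>\<^sup>+y. ennreal (cmod (f t) * cmod (V y w) * exp \<bar>t * y\<bar>) \<partial>lborel \<partial>lborel) \<le> ennreal B"
  shows "integrable lborel (\<lambda>w. indicator S w *\<^sub>R V y w)" "(LINT w|lborel. indicator S w *\<^sub>R V y w) = 0"
proof -
  have Vm [measurable]: "(\<lambda>(y, w). V y w) \<in> borel_measurable (borel \<Otimes>\<^sub>M borel)"
    unfolding V_def by measurable
  let ?k = "\<lambda>w t. indicator S w *\<^sub>R (f t * \<psi> (t - w))"
  have k: "integrable (lborel \<Otimes>\<^sub>M lborel) (\<lambda>(w, t). ?k w t)"
    by (rule windowed_fubini_integrable[OF _ _ _ sq S]) auto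
  have ke: "integrable (lborel \<Otimes>\<^sub>M lborel) (\<lambda>(w, t). ?k w t * iexp (- (t * y)))" for y
    by (rule Bochner_Integration.integrable_bound[OF k]) (auto simp: norm_mult split_beta)
  define h where "h t = (LINT w|lborel. ?k w t)" for t
  have h: "integrable lborel h"
    unfolding h_def using lborel_pair.integrable_snd[OF k] by simp
  have Vk: "(CLINT t|lborel. ?k w t * iexp (- (t * y))) = indicator S w *\<^sub>R V y w" for w y
    unfolding V_def by (simp add: scaleR_conv_of_real mult.assoc)
  show "integrable lborel (\<lambda>w. indicator S w *\<^sub>R V y w)"
    using lborel_pair.integrable_fst[OF ke[of y]] unfolding Vk .
  have H: "(CLINT t|lborel. h t * iexp (- (t * y))) = (LINT w|lborel. indicator S w *\<^sub>R V y w)" for y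
  proof -
    have "(CLINT t|lborel. h t * iexp (- (t * y))) = (CLINT t|lborel. CLINT w|lborel. ?k w t * iexp (- (t * y)))"
      unfolding h_def by (simp only: integral_mult_left_zero)
    also have "\<dots> = (CLINT w|lborel. CLINT t|lborel. ?k w t * iexp (- (t * y)))"
      by (rule lborel_pair.Fubini_integral[OF ke])
    finally show ?thesis unfolding Vk .
  qed
  define C where "C = emeasure lborel S + (\<integral>\<^sup>+w. ennreal ((cmod (\<psi> w))\<^sup>2) \<partial>lborel)"
  have C: "C < \<infinity>" using S sq by (simp add: C_def integrable_iff_bounded)
  have hle: "ennreal (cmod (h t)) \<le> C * ennreal (cmod (f t))" for t
  proof -
    have "ennreal (cmod (h t)) \<le> (\<integral>\<^sup>+w. ennreal (norm (?k w t)) \<partial>lborel)"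
    proof (cases "integrable lborel (\<lambda>w. ?k w t)")
      case True
      then show ?thesis unfolding h_def by (rule integral_norm_bound_ennreal)
    next
      case False
      then show ?thesis unfolding h_def by (simp add: not_integrable_integral_eq)
    qed
    also have "\<dots> \<le> (\<integral>\<^sup>+w. (indicator S w + ennreal ((cmod (\<psi> (t - w)))\<^sup>2)) * ennreal (cmod (f t)) \<partial>lborel)"
    proof (rule nn_integral_mono)
      fix w
      have "cmod (\<psi> (t - w)) \<le> 1 + (cmod (\<psi> (t - w)))\<^sup>2"
        using zero_le_power2[of "cmod (\<psi> (t - w)) - 1"] norm_ge_zero[of "\<psi> (t - w)"]
        unfolding power2_diff one_power2 by linarith
      then have "cmod (f t) * cmod (\<psi> (t - w)) \<le> (1 + (cmod (\<psi> (t - w)))\<^sup>2) * cmod (f t)"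
        by (subst mult.commute) (rule mult_right_mono, auto)
      then have "ennreal (cmod (f t) * cmod (\<psi> (t - w))) \<le> ennreal ((1 + (cmod (\<psi> (t - w)))\<^sup>2) * cmod (f t))"
        by (rule ennreal_leI)
      also have "\<dots> = (1 + ennreal ((cmod (\<psi> (t - w)))\<^sup>2)) * ennreal (cmod (f t))"
        by (simp only: ennreal_mult ennreal_plus zero_le_one zero_le_power2 norm_ge_zero add_nonneg_nonneg ennreal_1)
      finally show "ennreal (norm (?k w t)) \<le> (indicator S w + ennreal ((cmod (\<psi> (t - w)))\<^sup>2)) * ennreal (cmod (f t))"
        by (cases "w \<in> S") (simp_all add: norm_mult)
    qed
    also have "\<dots> = (emeasure lborel S + (\<integral>\<^sup>+w. ennreal ((cmod (\<psi> (t - w)))\<^sup>2) \<partial>lborel)) * ennreal (cmod (f t))"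
      by (simp add: nn_integral_multc nn_integral_add)
    also have "(\<integral>\<^sup>+w. ennreal ((cmod (\<psi> (t - w)))\<^sup>2) \<partial>lborel) = (\<integral>\<^sup>+w. ennreal ((cmod (\<psi> w))\<^sup>2) \<partial>lborel)"
      by (subst (2) nn_integral_real_affine[where c = "- 1" and t = t]) simp_all
    finally show ?thesis by (simp add: C_def)
  qed
  have hm [measurable]: "h \<in> borel_measurable borel" using h by auto
  have "(CLINT t|lborel. h t * iexp (- (t * y))) = 0"
  proof (rule beurling[OF h])
    have "(\<integral>\<^sup>+t. \<integral>\<^sup>+y. ennreal (cmod (h t) * cmod (LINT w|lborel. indicator S w *\<^sub>R V y w) * exp \<bar>t * y\<bar>) \<partial>lborel \<partial>lborel)
      \<le> (\<integral>\<^sup>+t. \<integral>\<^sup>+y. \<integral>\<^sup>+w. C * (indicator S w * ennreal (cmod (f t) * cmod (V y w) * exp \<bar>t * y\<bar>)) \<partial>lborel \<partial>lborel \<partial>lborel)"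
    proof (intro nn_integral_mono)
      fix t y :: real
      have "ennreal (cmod (LINT w|lborel. indicator S w *\<^sub>R V y w)) \<le> (\<integral>\<^sup>+w. ennreal (norm (indicator S w *\<^sub>R V y w)) \<partial>lborel)"
        by (rule integral_norm_bound_ennreal) (use lborel_pair.integrable_fst[OF ke[of y]] in \<open>unfold Vk\<close>)
      then have "ennreal (cmod (h t) * cmod (LINT w|lborel. indicator S w *\<^sub>R V y w) * exp \<bar>t * y\<bar>)
          \<le> (C * ennreal (cmod (f t))) * (\<integral>\<^sup>+w. ennreal (norm (indicator S w *\<^sub>R V y w)) \<partial>lborel) * ennreal (exp \<bar>t * y\<bar>)"
        unfolding ennreal_mult[OF mult_nonneg_nonneg[OF norm_ge_zero norm_ge_zero] exp_ge_zero] ennreal_mult[OF norm_ge_zero norm_ge_zero]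
        by (intro mult_mono hle) auto
      also have "\<dots> = (\<integral>\<^sup>+w. (C * ennreal (cmod (f t))) * ennreal (norm (indicator S w *\<^sub>R V y w)) * ennreal (exp \<bar>t * y\<bar>) \<partial>lborel)"
        by (simp add: nn_integral_multc nn_integral_cmult)
      also have "\<dots> = (\<integral>\<^sup>+w. C * (indicator S w * ennreal (cmod (f t) * cmod (V y w) * exp \<bar>t * y\<bar>)) \<partial>lborel)"
        by (intro nn_integral_cong) (auto simp: indicator_def ennreal_mult mult_ac)
      finally show "ennreal (cmod (h t) * cmod (LINT w|lborel. indicator S w *\<^sub>R V y w) * exp \<bar>t * y\<bar>) \<le> \<dots>" .
    qed
    also have "\<dots> = (\<integral>\<^sup>+t. \<integral>\<^sup>+w. \<integral>\<^sup>+y. C * (indicator S w * ennreal (cmod (f t) * cmod (V y w) * exp \<bar>t * y\<bar>)) \<partial>lborel \<partial>lborel \<partial>lborel)"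
      by (intro nn_integral_cong lborel_pair.Fubini') measurable
    also have "\<dots> = (\<integral>\<^sup>+w. \<integral>\<^sup>+t. \<integral>\<^sup>+y. C * (indicator S w * ennreal (cmod (f t) * cmod (V y w) * exp \<bar>t * y\<bar>)) \<partial>lborel \<partial>lborel \<partial>lborel)"
      by (rule lborel_pair.Fubini') measurable
    also have "\<dots> = (\<integral>\<^sup>+w. C * (indicator S w * (\<integral>\<^sup>+t. \<integral>\<^sup>+y. ennreal (cmod (f t) * cmod (V y w) * exp \<bar>t * y\<bar>) \<partial>lborel \<partial>lborel)) \<partial>lborel)"
      by (simp add: nn_integral_cmult)
    also have "\<dots> \<le> (\<integral>\<^sup>+w. C * ennreal B * indicator S w \<partial>lborel)"
      by (intro nn_integral_mono) (auto simp: indicator_def intro!: mult_left_mono bnd)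
    also have "\<dots> = C * ennreal B * emeasure lborel S" by (simp add: nn_integral_cmult)
    also have "\<dots> < \<infinity>" using C S by (simp add: ennreal_mult_less_top)
    finally show "(\<integral>\<^sup>+t. \<integral>\<^sup>+y. ennreal (cmod (h t) * cmod (CLINT t|lborel. h t * iexp (- (t * y))) * exp \<bar>t * y\<bar>) \<partial>lborel \<partial>lborel) < \<infinity>"
      unfolding H .
  qed
  then show "(LINT w|lborel. indicator S w *\<^sub>R V y w) = 0" unfolding H .
qed

text \<open>
  The weighted integral $N(w)$ is finite but not uniformly bounded. The sets
  $S_n = \{w : |w| \le n,\ N(w) \le n\}$ exhaust the line, and every measurable subset of $S_n$ is an
  admissible set of positions for \<open>averaged_window_transform_vanishes\<close>. So for each $y$ the transform
  $V(y,w)$ vanishes for almost every $w$. Rational $y$ and continuity in $y$ give one null set of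
  positions outside of which $V(\cdot,w) = 0$, that is, $f(t)\psi(t-w) = 0$ for almost every $t$. Fubini's
  theorem and $\psi \neq 0$ yield $f = 0$.
\<close>
theorem beurling_all_windows:
  fixes f \<psi> :: "real \<Rightarrow> complex"
  defines "V \<equiv> \<lambda>y w. CLINT t|lborel. f t * \<psi> (t - w) * iexp (- (t * y))"
  assumes fm: "f \<in> borel_measurable borel" and \<psi>m: "\<psi> \<in> borel_measurable borel"
    and sq: "integrable lborel (\<lambda>t. (cmod (f t))\<^sup>2)" "integrable lborel (\<lambda>t. (cmod (\<psi> t))\<^sup>2)"
    and nz: "\<not> (AE t in lborel. \<psi> t = 0)"
    and fin: "\<And>w. (\<integral>\<^sup>+t. \<integral>\<^sup>+y. ennreal (cmod (f t) * cmod (V y w) * exp \<bar>t * y\<bar>) \<partial>lborel \<partial>lborel) < \<infinity>"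
  shows "AE t in lborel. f t = 0"
proof -
  note [measurable] = fm \<psi>m
  have [measurable]: "(\<lambda>(y, w). V y w) \<in> borel_measurable (borel \<Otimes>\<^sub>M borel)"
    unfolding V_def by measurable
  define N where "N w = (\<integral>\<^sup>+t. \<integral>\<^sup>+y. ennreal (cmod (f t) * cmod (V y w) * exp \<bar>t * y\<bar>) \<partial>lborel \<partial>lborel)" for w
  have [measurable]: "N \<in> borel_measurable borel" unfolding N_def by measurable
  define S where "S n = {w. \<bar>w\<bar> \<le> real n \<and> N w \<le> ennreal (real n)}" for n :: nat
  have Sm [measurable]: "S n \<in> sets borel" for n unfolding S_def by measurable
  have S_fin: "emeasure lborel (S n) < \<infinity>" for n
  proof -
    have "emeasure lborel (S n) \<le> emeasure lborel {- real n..real n}"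
      by (intro emeasure_mono) (auto simp: S_def)
    then show ?thesis by (rule order_le_less_trans) (simp add: emeasure_lborel_Icc_eq)
  qed
  have S_cover: "\<exists>n. w \<in> S n" for w
  proof -
    obtain n :: nat where n: "max \<bar>w\<bar> (enn2real (N w)) \<le> real n" using real_arch_simple by blast
    have "N w = ennreal (enn2real (N w))" using fin[of w] by (simp add: N_def)
    also have "\<dots> \<le> ennreal (real n)" using n by (intro ennreal_leI) simp
    finally show ?thesis using n by (auto simp: S_def)
  qed
  have V0: "AE w in lborel. V y w = 0" for y
  proof -
    \<comment> \<open>A function all of whose integrals over measurable sets vanish is zero almost everywhere.\<close>
    have "AE w in lborel. indicator (S n) w *\<^sub>R V y w = 0" for n
    proof (rule sigma_finite_measure.density_zero[OF sigma_finite_lborel])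
      have bnd: "N w \<le> ennreal (real n)" if "w \<in> S n" for w using that by (simp add: S_def)
      show "integrable lborel (\<lambda>w. indicator (S n) w *\<^sub>R V y w)"
        unfolding V_def
        by (rule averaged_window_transform_vanishes(1)[OF fm \<psi>m Sm sq S_fin bnd[unfolded N_def V_def]])
      fix A :: "real set" assume "A \<in> sets lborel"
      then have A [measurable]: "A \<in> sets borel" by simp
      have "emeasure lborel (A \<inter> S n) \<le> emeasure lborel (S n)" by (intro emeasure_mono) auto
      then have Afin: "emeasure lborel (A \<inter> S n) < \<infinity>" using S_fin by (rule order_le_less_trans)
      have "(LINT w|lborel. indicator (A \<inter> S n) w *\<^sub>R V y w) = 0"
        unfolding V_def
        by (rule averaged_window_transform_vanishes(2)[OF fm \<psi>m _ sq Afin bnd[unfolded N_def V_def]]) auto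
      then show "set_lebesgue_integral lborel A (\<lambda>w. indicator (S n) w *\<^sub>R V y w) = 0"
        by (simp add: set_lebesgue_integral_def indicator_inter_arith)
    qed
    then have "AE w in lborel. \<forall>n. indicator (S n) w *\<^sub>R V y w = 0"
      unfolding AE_all_countable by blast
    then show ?thesis
    proof eventually_elim
      case (elim w)
      obtain n where "w \<in> S n" using S_cover by blast
      then show ?case using elim[rule_format, of n] by simp
    qed
  qed
  have "AE w in lborel. \<forall>y\<in>\<rat>. V y w = 0"
    using V0 by (subst AE_ball_countable) (auto simp: countable_rat)
  then have "AE w in lborel. AE t in lborel. f t * \<psi> (t - w) = 0"
  proof eventually_elim
    case (elim w)
    have int: "integrable lborel (\<lambda>t. f t * \<psi> (t - w))"
      by (rule windowed_section_integrable[OF fm \<psi>m sq])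
    have "V y w = 0" for y
    proof (rule continuous_constant_on_closure[where S = \<rat> and f = "\<lambda>y. V y w"])
      show "continuous_on (closure \<rat>) (\<lambda>y. V y w)"
        unfolding Rats_closure_real V_def by (rule fourier_continuous[OF int])
    qed (use elim Rats_closure_real in auto)
    then show ?case unfolding V_def by (rule fourier_injective[OF int])
  qed
  moreover have "{p \<in> space (lborel \<Otimes>\<^sub>M lborel). f (fst p) * \<psi> (fst p - snd p) = 0} \<in> sets (lborel \<Otimes>\<^sub>M lborel)"
    by measurable
  note lborel_pair.AE_commute[OF this]
  ultimately have "AE t in lborel. AE w in lborel. f t * \<psi> (t - w) = 0"
    by blast
  then show ?thesis
  proof eventually_elim
    case (elim t)
    show "f t = 0"
    proof (rule ccontr)
      assume "f t \<noteq> 0"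
      then have "AE w in lborel. ennreal (cmod (\<psi> (t - w))) = 0" using elim by simp
      then have "(\<integral>\<^sup>+w. ennreal (cmod (\<psi> (t - w))) \<partial>lborel) = 0"
        by (subst nn_integral_0_iff_AE) auto
      moreover have "(\<integral>\<^sup>+w. ennreal (cmod (\<psi> w)) \<partial>lborel) = (\<integral>\<^sup>+w. ennreal (cmod (\<psi> (t - w))) \<partial>lborel)"
        by (subst nn_integral_real_affine[where c = "- 1" and t = t]) simp_all
      ultimately have "(\<integral>\<^sup>+w. ennreal (cmod (\<psi> w)) \<partial>lborel) = 0" by simp
      then have "AE w in lborel. ennreal (cmod (\<psi> w)) = 0"
        by (subst (asm) nn_integral_0_iff_AE) auto
      then show False using nz by simp
    qed
  qed
qed

section \<open>The windowed offset linear canonical transform\<close>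

text \<open>
  Borel representatives make the integrands on the plane measurable for the product
  sigma-algebra, which is what Fubini's theorem needs.
\<close>
lemma lebesgue_borel_representative:
  fixes f :: "real \<Rightarrow> complex"
  assumes "f \<in> borel_measurable lebesgue"
  obtains g where "g \<in> borel_measurable borel" "AE t in lborel. f t = g t"
proof -
  have "(\<lambda>t. Re (f t)) \<in> borel_measurable lebesgue" "(\<lambda>t. Im (f t)) \<in> borel_measurable lebesgue"
    using assms by measurable
  from this[THEN completion_ex_borel_measurable_real]
  obtain r i where [measurable]: "r \<in> borel_measurable lborel" "i \<in> borel_measurable lborel"
    and ae: "AE t in lborel. Re (f t) = r t" "AE t in lborel. Im (f t) = i t"
    by blast
  show thesis
  proof
    show "(\<lambda>t. Complex (r t) (i t)) \<in> borel_measurable borel"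
      unfolding Complex_eq by measurable
    show "AE t in lborel. f t = Complex (r t) (i t)"
      using ae by eventually_elim (simp add: complex_eq_iff)
  qed
qed

lemma AE_lborel_shift:
  assumes "AE t in lborel. P t"
  shows "AE t::real in lborel. P (t - w)"
proof -
  obtain N where N: "N \<in> null_sets lborel" "{t. \<not> P t} \<subseteq> N"
    using assms by (auto simp: eventually_ae_filter)
  show ?thesis
    by (rule AE_I'[OF null_sets_translation[OF N(1), of w]]) (use N(2) in auto)
qed

lemma square_integrable_representative:
  assumes "square_integrable f"
  obtains g where "g \<in> borel_measurable borel" "AE t in lborel. f t = g t"
    "integrable lborel (\<lambda>t. (cmod (g t))\<^sup>2)"
proof -
  have f: "f \<in> borel_measurable lebesgue" "integrable lebesgue (\<lambda>t. (cmod (f t))\<^sup>2)"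
    using assms by (simp_all add: square_integrable_def)
  obtain g where g: "g \<in> borel_measurable borel" "AE t in lborel. f t = g t"
    by (rule lebesgue_borel_representative[OF f(1)])
  have [measurable]: "g \<in> borel_measurable lborel" using g by simp
  have "AE t in lebesgue. (cmod (f t))\<^sup>2 = (cmod (g t))\<^sup>2"
    by (rule AE_completion) (use g(2) in \<open>eventually_elim, simp\<close>)
  then have "integrable lebesgue (\<lambda>t. (cmod (g t))\<^sup>2)"
    by (rule integrable_cong_AE_imp[OF f(2) _, rotated])
      (auto intro!: measurable_completion elim: eventually_mono)
  then have "integrable lborel (\<lambda>t. (cmod (g t))\<^sup>2)"
    by (simp add: integrable_completion)
  with g show thesis by (rule that)
qed

text \<open>
  Only the last factor involves both variables. The first one has constant modulus, so the
  modulus of the transform is that of an ordinary Fourier transform at the frequency $u/b$.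
\<close>
lemma olct_kernel_factor:
  "olct_kernel a b c d u0 w0 t u =
     (1 / csqrt (\<i> * of_real (2 * pi * b)) *
        iexp (d / (2 * b) * (u\<^sup>2 + u0\<^sup>2) - 1 / b * u * (d * u0 - b * w0))) *
     (iexp (a / (2 * b) * t\<^sup>2 + 1 / b * t * u0) * iexp (- (t * (u / b))))"
  unfolding olct_kernel_def mult.assoc exp_add[symmetric]
  by (simp add: algebra_simps diff_divide_distrib add_divide_distrib)

theorem theorem3:
  fixes a b c d u0 w0 :: real
    and \<phi> f :: "real \<Rightarrow> complex"
  assumes "a * d - b * c = 1" and "b \<noteq> 0"
    and "square_integrable \<phi>"
    and "\<not> (AE t in lebesgue. \<phi> t = 0)"
    and "square_integrable f"
    and "\<And>w. square_integrable (\<lambda>u. wolct a b c d u0 w0 \<phi> f u w)"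
    and "\<And>w. (\<integral>\<^sup>+ (t, u). ennreal (cmod (f t * wolct a b c d u0 w0 \<phi> f u w) * exp \<bar>t * u / b\<bar>)
                  \<partial>(lebesgue :: (real \<times> real) measure)) < \<infinity>"
  shows "AE t in lebesgue. f t = 0"
proof -
  have b: "b \<noteq> 0" by fact
  obtain g where g: "g \<in> borel_measurable borel" "AE t in lborel. f t = g t"
    and g2: "integrable lborel (\<lambda>t. (cmod (g t))\<^sup>2)"
    by (rule square_integrable_representative[OF assms(5)])
  obtain \<gamma> where \<gamma>: "\<gamma> \<in> borel_measurable borel" "AE t in lborel. \<phi> t = \<gamma> t"
    and \<gamma>2: "integrable lborel (\<lambda>t. (cmod (\<gamma> t))\<^sup>2)"
    by (rule square_integrable_representative[OF assms(3)])
  note [measurable] = g(1) \<gamma>(1)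
  \<comment> \<open>The chirp is absorbed into \<open>f\<close>, the conjugation into the window.\<close>
  define F where "F t = g t * iexp (a / (2 * b) * t\<^sup>2 + 1 / b * t * u0)" for t
  define \<psi> where "\<psi> t = cnj (\<gamma> t)" for t
  have Fm [measurable]: "F \<in> borel_measurable borel" unfolding F_def by measurable
  have \<psi>m [measurable]: "\<psi> \<in> borel_measurable borel"
    unfolding \<psi>_def by (rule borel_measurable_continuous_on[OF _ \<gamma>(1)]) (intro continuous_intros)
  have F_norm: "cmod (F t) = cmod (g t)" for t by (simp add: F_def norm_mult)
  define V where "V y w = (CLINT t|lborel. F t * \<psi> (t - w) * iexp (- (t * y)))" for y w
  have [measurable]: "(\<lambda>(y, w). V y w) \<in> borel_measurable (borel \<Otimes>\<^sub>M borel)"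
    unfolding V_def by measurable
  define k where "k = cmod (1 / csqrt (\<i> * of_real (2 * pi * b)))"
  have k: "k > 0" using b by (simp add: k_def)
  have wolct_norm: "cmod (wolct a b c d u0 w0 \<phi> f u w) = k * cmod (V (u / b) w)" for u w
  proof -
    let ?\<kappa> = "1 / csqrt (\<i> * of_real (2 * pi * b)) *
        iexp (d / (2 * b) * (u\<^sup>2 + u0\<^sup>2) - 1 / b * u * (d * u0 - b * w0))"
    let ?G = "\<lambda>t. ?\<kappa> * (F t * \<psi> (t - w) * iexp (- (t * (u / b))))"
    have Gm: "?G \<in> borel_measurable lborel" by measurable
    have ae: "AE t in lborel. f t * cnj (\<phi> (t - w)) * olct_kernel a b c d u0 w0 t u = ?G t"
      using g(2) AE_lborel_shift[OF \<gamma>(2), of w]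
      by eventually_elim (simp only: olct_kernel_factor F_def \<psi>_def mult_ac)
    have "wolct a b c d u0 w0 \<phi> f u w = (CLINT t|lebesgue. ?G t)"
      unfolding wolct_def
    proof (rule integral_cong_AE)
      show "?G \<in> borel_measurable lebesgue" using Gm by (rule measurable_completion)
      show ae': "AE t in lebesgue. f t * cnj (\<phi> (t - w)) * olct_kernel a b c d u0 w0 t u = ?G t"
        using ae by (rule AE_completion)
      show "(\<lambda>t. f t * cnj (\<phi> (t - w)) * olct_kernel a b c d u0 w0 t u) \<in> borel_measurable lebesgue"
        by (rule borel_measurable_AE[OF measurable_completion[OF Gm]])
          (use ae in \<open>auto intro: AE_completion elim: eventually_mono\<close>)
    qed
    also have "\<dots> = (CLINT t|lborel. ?G t)" by (rule integral_completion[OF Gm])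
    also have "\<dots> = ?\<kappa> * V (u / b) w" unfolding V_def by (rule integral_mult_right_zero)
    finally show ?thesis by (simp only: norm_mult k_def norm_exp_i_times mult_1_right)
  qed
  have "AE t in lborel. F t = 0"
  proof (rule beurling_all_windows[OF Fm \<psi>m])
    show "integrable lborel (\<lambda>t. (cmod (F t))\<^sup>2)" "integrable lborel (\<lambda>t. (cmod (\<psi> t))\<^sup>2)"
      using g2 \<gamma>2 by (simp_all add: F_norm \<psi>_def)
    show "\<not> (AE t in lborel. \<psi> t = 0)"
    proof
      assume "AE t in lborel. \<psi> t = 0"
      with \<gamma>(2) have "AE t in lborel. \<phi> t = 0" by eventually_elim (simp add: \<psi>_def)
      with assms(4) show False by (simp add: AE_completion)
    qed
    fix w
    \<comment> \<open>The substitution \<open>u = b * y\<close> turns the hypothesis into the one of \<open>beurling_all_windows\<close>.\<close>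
    let ?I = "\<lambda>t y. ennreal (cmod (F t) * cmod (V y w) * exp \<bar>t * y\<bar>)"
    obtain N where N: "N \<in> null_sets lborel" "{t. f t \<noteq> g t} \<subseteq> N"
      using g(2) by (auto simp: eventually_ae_filter)
    have [measurable]: "N \<in> sets borel" using N by auto
    have "AE t in lborel. t \<notin> N" using N(1) by (rule AE_not_in)
    then have "AE t in lborel. AE u::real in lborel. fst (t, u) \<notin> N"
      by eventually_elim simp
    moreover have "{p \<in> space (lborel \<Otimes>\<^sub>M lborel). fst p \<notin> N} \<in> sets (lborel \<Otimes>\<^sub>M (lborel :: real measure))"
      by measurable
    ultimately have "AE p in lborel \<Otimes>\<^sub>M (lborel :: real measure). fst p \<notin> N"
      by (intro lborel_pair.AE_pair_measure)
    then have ae: "AE p in lborel \<Otimes>\<^sub>M lborel. 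
        (case p of (t, u) \<Rightarrow> ennreal (cmod (f t * wolct a b c d u0 w0 \<phi> f u w) * exp \<bar>t * u / b\<bar>))
      = (case p of (t, u) \<Rightarrow> ennreal k * ?I t (u / b))"
    proof eventually_elim
      case (elim p)
      then have "f (fst p) = g (fst p)" using N(2) by auto
      then show ?case
        using k by (cases p) (simp add: norm_mult wolct_norm F_norm ennreal_mult'[symmetric] mult_ac)
    qed
    have "ennreal k * (ennreal \<bar>b\<bar> * (\<integral>\<^sup>+t. \<integral>\<^sup>+y. ?I t y \<partial>lborel \<partial>lborel))
        = (\<integral>\<^sup>+t. ennreal k * (ennreal \<bar>b\<bar> * (\<integral>\<^sup>+y. ?I t y \<partial>lborel)) \<partial>lborel)"
      by (simp add: nn_integral_cmult)
    also have "\<dots> = (\<integral>\<^sup>+t. \<integral>\<^sup>+u. ennreal k * ?I t (u / b) \<partial>lborel \<partial>lborel)"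
    proof (rule nn_integral_cong)
      fix t
      have "(\<integral>\<^sup>+u. ?I t (u / b) \<partial>lborel) = ennreal \<bar>b\<bar> * (\<integral>\<^sup>+y. ?I t y \<partial>lborel)"
        by (subst nn_integral_real_affine[where c = b and t = 0]) (use b in simp_all)
      then show "ennreal k * (ennreal \<bar>b\<bar> * (\<integral>\<^sup>+y. ?I t y \<partial>lborel)) = (\<integral>\<^sup>+u. ennreal k * ?I t (u / b) \<partial>lborel)"
        by (simp add: nn_integral_cmult)
    qed
    also have "\<dots> = (\<integral>\<^sup>+p. (case p of (t, u) \<Rightarrow> ennreal k * ?I t (u / b)) \<partial>(lborel \<Otimes>\<^sub>M lborel))"
      by (subst lborel.nn_integral_fst[symmetric]) auto
    also have "\<dots> = (\<integral>\<^sup>+ (t, u). ennreal (cmod (f t * wolct a b c d u0 w0 \<phi> f u w) * exp \<bar>t * u / b\<bar>) \<partial>(lborel \<Otimes>\<^sub>M lborel))"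
      using ae by (intro nn_integral_cong_AE) (auto elim: eventually_mono)
    also have "\<dots> < \<infinity>"
      using assms(7)[of w] by (simp add: nn_integral_completion lborel_prod)
    finally show "(\<integral>\<^sup>+t. \<integral>\<^sup>+y. ennreal (cmod (F t) * cmod (CLINT s|lborel. F s * \<psi> (s - w) * iexp (- (s * y))) * exp \<bar>t * y\<bar>) \<partial>lborel \<partial>lborel) < \<infinity>"
      unfolding V_def[symmetric] using k b by (auto simp: ennreal_mult_less_top)
  qed
  with g(2) have "AE t in lborel. f t = 0"
    by eventually_elim (simp add: F_def)
  then show ?thesis by (rule AE_completion)
qed

end
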